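(* Let $0<\alpha<1$, let $T>0$, let $\Omega\subset\mathbb{R}^d$ ($d\in\{1,2,3\}$) be a bounded domain, and let $\phi$ be a (sufficiently regular, in the sense made precise in the context) solution on $\Omega\times(0,T)$ of the time fractional gradient flow $${}_0D_t^\alpha\phi=-\mathrm{grad}_H E(\phi).$$ Let $0=t_0<t_1<\cdots<t_M=T$ be an arbitrary time mesh, and let $\overline{E}(\phi(t))$ be the associated non-local energy $$\overline{E}(\phi(t))=\begin{cases}E(\phi(t)), & t\in[t_0,t_1],\\ E(\phi(t))+F_h(t_1,t;\phi), & t\in[t_1,t_2],\\ E(\phi(t))+F_h(t_n,t;\phi)+\sum_{k=1}^{n-1}F_h(t_k,t_{k+1};\phi), & t\in[t_n,t_{n+1}],\ n=2,\dots,M-1.\end{cases}$$ Then for all $n=0,1,\dots,M-1$, $$\overline{E}(\phi(t_{n+1}))-\overline{E}(\phi(t_n))=-\int_\Omega \mathcal{A}_\alpha^{t_n,t_{n+1}}(\partial_t\phi,\partial_t\phi)\,dx\le 0 .$$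
   Context: $(\cdot,\cdot)$ denotes the $L^2(\Omega)$ inner product. The Caputo derivative is $${}_0D_t^\alpha\phi(t)=\frac{1}{\Gamma(1-\alpha)}\int_0^t(t-s)^{-\alpha}\partial_s\phi(s)\,ds .$$ $E$ is a free energy functional and $\mathrm{grad}_H E$ is its functional derivative, which satisfies along the solution the chain rule $\frac{d}{dt}E(\phi(t))=(\mathrm{grad}_H E(\phi),\partial_t\phi)$. For $0<\hat t<t$ the history part of the fractional derivative is $$D_{h,t}^{\alpha,\hat t}\phi=\frac{1}{\Gamma(1-\alpha)}\int_0^{\hat t}(t-s)^{-\alpha}\partial_s\phi(s)\,ds,$$ and $$F_h(\hat t,t;\phi)=\int_\Omega\int_{\hat t}^t D_{h,s}^{\alpha,\hat t}\phi\;\frac{\partial\phi}{\partial s}\,ds\,dx,$$ with $F_h(\hat t,\hat t;\phi)=0$ (so the definition of $\overline{E}$ is consistent at the common endpoints of the intervals). For $0\le\hat t<t$ and functions $\varphi,\psi$ of time (for functions also depending on $x\in\Omega$ the form is applied pointwise in $x$), $$\mathcal{A}_\alpha^{\hat t,t}(\varphi,\psi)=\frac{1}{\Gamma(1-\alpha)}\int_{\hat t}^t\int_{\hat t}^s(s-\sigma)^{-\alpha}\varphi(\sigma)\psi(s)\,d\sigma\,ds .$$ Regularity: $\partial_t\phi\in L^2(0,T;L^2(\Omega))$, the equation ${}_0D_t^\alpha\phi=-\mathrm{grad}_H E(\phi)$ holds in $L^2(\Omega)$ for almost every $t\in(0,T)$, and $t\mapsto E(\phi(t))$ is absolutely continuous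 on $[0,T]$ with the chain rule $\frac{d}{dt}E(\phi(t))=(\mathrm{grad}_H E(\phi),\partial_t\phi)$ holding for almost every $t$. *)

theory Defs
  imports "HOL-Analysis.Analysis"
begin

text \<open>
  Conventions. Elements of L2 spaces are handled through Borel representatives, and equality
  in L2 is equality almost everywhere. A field on space-time is a curried function
  \<open>\<phi> :: real \<Rightarrow> 'a \<Rightarrow> real\<close> (time first). Its time derivative is a separate function \<open>d\<phi>\<close>,
  tied to \<open>\<phi>\<close> by \<open>has_L2_time_derivative\<close>; operators that the paper applies to \<open>\<phi>\<close> but which
  only see its time derivative take \<open>d\<phi>\<close> as their argument.
\<close>

definition L2_on :: "'a::euclidean_space set \<Rightarrow> ('a \<Rightarrow> real) \<Rightarrow> bool" where
  "L2_on S u \<longleftrightarrow> set_borel_measurable lborel S u \<and> set_integrable lborel S (\<lambda>x. (u x)\<^sup>2)"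

definition L2_inner :: "'a::euclidean_space set \<Rightarrow> ('a \<Rightarrow> real) \<Rightarrow> ('a \<Rightarrow> real) \<Rightarrow> real" where
  "L2_inner \<Omega> u v = (LINT x:\<Omega>|lborel. u x * v x)"

primrec C_diff :: "nat \<Rightarrow> ('a::euclidean_space \<Rightarrow> real) \<Rightarrow> bool" where
  "C_diff 0 f \<longleftrightarrow> continuous_on UNIV f"
| "C_diff (Suc k) f \<longleftrightarrow>
     (\<exists>f'. (\<forall>x. (f has_derivative f' x) (at x)) \<and> (\<forall>b\<in>Basis. C_diff k (\<lambda>x. f' x b)))"

definition test_function :: "'a::euclidean_space set \<Rightarrow> ('a \<Rightarrow> real) \<Rightarrow> bool" where
  "test_function \<Omega> v \<longleftrightarrow> (\<forall>k. C_diff k v) \<and>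
     compact (closure {x. v x \<noteq> 0}) \<and> closure {x. v x \<noteq> 0} \<subseteq> \<Omega>"

text \<open>
  \<open>g\<close> is the functional derivative of \<open>E\<close> at \<open>u\<close> with respect to the L2 inner product. Only
  compactly supported smooth variations are used, so \<open>E\<close> need not be meaningful on all of L2.
\<close>

definition has_functional_derivative ::
    "'a::euclidean_space set \<Rightarrow> (('a \<Rightarrow> real) \<Rightarrow> real) \<Rightarrow> ('a \<Rightarrow> real) \<Rightarrow> ('a \<Rightarrow> real) \<Rightarrow> bool" where
  "has_functional_derivative \<Omega> E u g \<longleftrightarrow> L2_on \<Omega> g \<and>
     (\<forall>v. test_function \<Omega> v \<longrightarrow>
        ((\<lambda>\<epsilon>. E (\<lambda>x. u x + \<epsilon> * v x)) has_real_derivative L2_inner \<Omega> g v) (at 0))"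

text \<open>
  \<open>d\<phi>\<close> lies in L2(0,T; L2(\<open>\<Omega>\<close>)), identified with L2 of the space-time cylinder, and is the weak
  time derivative of \<open>\<phi>\<close>, where \<open>\<phi>\<close> is the representative that is continuous from [0,T]
  into L2(\<open>\<Omega>\<close>).
\<close>

definition has_L2_time_derivative ::
    "real \<Rightarrow> 'a::euclidean_space set \<Rightarrow> (real \<Rightarrow> 'a \<Rightarrow> real) \<Rightarrow> (real \<Rightarrow> 'a \<Rightarrow> real) \<Rightarrow> bool" where
  "has_L2_time_derivative T \<Omega> \<phi> d\<phi> \<longleftrightarrow>
     L2_on ({0<..<T} \<times> \<Omega>) (\<lambda>(t, x). d\<phi> t x) \<and>
     (\<forall>t\<in>{0..T}. L2_on \<Omega> (\<phi> t) \<and>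
        (AE x\<in>\<Omega> in lborel. \<phi> t x = \<phi> 0 x + (LINT s:{0..t}|lborel. d\<phi> s x)))"

definition abs_continuous_on_interval :: "real \<Rightarrow> real \<Rightarrow> (real \<Rightarrow> real) \<Rightarrow> bool" where
  "abs_continuous_on_interval a b f \<longleftrightarrow>
     (\<forall>\<epsilon>>0. \<exists>\<delta>>0. \<forall>(n::nat) l r.
        (\<forall>i<n. a \<le> l i \<and> l i \<le> r i \<and> r i \<le> b) \<longrightarrow>
        disjoint_family_on (\<lambda>i. {l i<..<r i}) {..<n} \<longrightarrow>
        (\<Sum>i<n. r i - l i) < \<delta> \<longrightarrow> (\<Sum>i<n. \<bar>f (r i) - f (l i)\<bar>) < \<epsilon>)"

definition history_derivative :: "real \<Rightarrow> real \<Rightarrow> (real \<Rightarrow> real) \<Rightarrow> real \<Rightarrow> real" where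
  "history_derivative \<alpha> t' f' t =
     1 / Gamma (1 - \<alpha>) * (LINT s:{0..t'}|lborel. (t - s) powr (-\<alpha>) * f' s)"

definition caputo_derivative :: "real \<Rightarrow> (real \<Rightarrow> real) \<Rightarrow> real \<Rightarrow> real" where
  "caputo_derivative \<alpha> f' t =
     1 / Gamma (1 - \<alpha>) * (LINT s:{0..t}|lborel. (t - s) powr (-\<alpha>) * f' s)"

definition F_hist ::
    "real \<Rightarrow> 'a::euclidean_space set \<Rightarrow> (real \<Rightarrow> 'a \<Rightarrow> real) \<Rightarrow> real \<Rightarrow> real \<Rightarrow> real" where
  "F_hist \<alpha> \<Omega> d\<phi> t' t =
     (LINT x:\<Omega>|lborel. LINT s:{t'..t}|lborel.
        history_derivative \<alpha> t' (\<lambda>\<sigma>. d\<phi> \<sigma> x) s * d\<phi> s x)"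

definition A_form :: "real \<Rightarrow> real \<Rightarrow> real \<Rightarrow> (real \<Rightarrow> real) \<Rightarrow> (real \<Rightarrow> real) \<Rightarrow> real" where
  "A_form \<alpha> t' t f g =
     1 / Gamma (1 - \<alpha>) *
       (LINT s:{t'..t}|lborel. LINT \<sigma>:{t'..s}|lborel. (s - \<sigma>) powr (-\<alpha>) * f \<sigma> * g s)"

definition fractional_gradient_flow ::
    "real \<Rightarrow> real \<Rightarrow> 'a::euclidean_space set \<Rightarrow> (('a \<Rightarrow> real) \<Rightarrow> real) \<Rightarrow>
     (('a \<Rightarrow> real) \<Rightarrow> 'a \<Rightarrow> real) \<Rightarrow> (real \<Rightarrow> 'a \<Rightarrow> real) \<Rightarrow> (real \<Rightarrow> 'a \<Rightarrow> real) \<Rightarrow> bool" where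
  "fractional_gradient_flow \<alpha> T \<Omega> E gradE \<phi> d\<phi> \<longleftrightarrow>
     has_L2_time_derivative T \<Omega> \<phi> d\<phi> \<and>
     (AE t\<in>{0<..<T} in lborel.
        has_functional_derivative \<Omega> E (\<phi> t) (gradE (\<phi> t)) \<and>
        (AE x\<in>\<Omega> in lborel. caputo_derivative \<alpha> (\<lambda>s. d\<phi> s x) t = - gradE (\<phi> t) x))"

definition time_mesh :: "real \<Rightarrow> nat \<Rightarrow> (nat \<Rightarrow> real) \<Rightarrow> bool" where
  "time_mesh T M \<tau> \<longleftrightarrow> \<tau> 0 = 0 \<and> \<tau> M = T \<and> strict_mono_on {0..M} \<tau>"

text \<open>
  At a mesh point two of the defining cases apply; the lemmas below show that they agree, so that
  each formula holds on the whole closed interval.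
\<close>

definition nonlocal_energy ::
    "real \<Rightarrow> 'a::euclidean_space set \<Rightarrow> (('a \<Rightarrow> real) \<Rightarrow> real) \<Rightarrow> (nat \<Rightarrow> real) \<Rightarrow>
     (real \<Rightarrow> 'a \<Rightarrow> real) \<Rightarrow> (real \<Rightarrow> 'a \<Rightarrow> real) \<Rightarrow> real \<Rightarrow> real" where
  "nonlocal_energy \<alpha> \<Omega> E \<tau> \<phi> d\<phi> t =
     (if t \<le> \<tau> 1 then E (\<phi> t)
      else if t \<le> \<tau> 2 then E (\<phi> t) + F_hist \<alpha> \<Omega> d\<phi> (\<tau> 1) t
      else let n = (LEAST n. t \<le> \<tau> (n + 1)) in
        E (\<phi> t) + F_hist \<alpha> \<Omega> d\<phi> (\<tau> n) t + (\<Sum>k=1..n-1. F_hist \<alpha> \<Omega> d\<phi> (\<tau> k) (\<tau> (k + 1))))"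

lemma F_hist_same [simp]: "F_hist \<alpha> \<Omega> d\<phi> t t = 0"
proof -
  have "(LINT s:{t..t}|lborel. f s) = 0" for f :: "real \<Rightarrow> real"
  proof -
    have "AE s in lborel. indicator {t..t} s *\<^sub>R f s = 0"
      using AE_lborel_singleton[of t] by eventually_elim (auto simp: indicator_def)
    then show ?thesis
      unfolding set_lebesgue_integral_def by (rule integral_eq_zero_AE)
  qed
  then show ?thesis
    by (simp add: F_hist_def set_lebesgue_integral_def)
qed

context
  fixes T :: real and M :: nat and \<tau> :: "nat \<Rightarrow> real"
  assumes mesh: "time_mesh T M \<tau>"
begin

lemma time_mesh_less: "i < j \<Longrightarrow> j \<le> M \<Longrightarrow> \<tau> i < \<tau> j"
  using mesh by (auto simp: time_mesh_def strict_mono_on_def)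

lemma time_mesh_le: "i \<le> j \<Longrightarrow> j \<le> M \<Longrightarrow> \<tau> i \<le> \<tau> j"
  using time_mesh_less[of i j] by (cases "i = j") auto

lemma time_mesh_index:
  assumes "n < M" "\<tau> n < t" "t \<le> \<tau> (n + 1)"
  shows "(LEAST n. t \<le> \<tau> (n + 1)) = n"
proof (rule Least_equality)
  show "n \<le> k" if "t \<le> \<tau> (k + 1)" for k
  proof (rule ccontr)
    assume "\<not> n \<le> k"
    then have "\<tau> (k + 1) \<le> \<tau> n" using assms(1) by (intro time_mesh_le) auto
    with that assms(2) show False by linarith
  qed
qed (use assms in auto)

lemma nonlocal_energy_first:
  "t \<in> {\<tau> 0..\<tau> 1} \<Longrightarrow> nonlocal_energy \<alpha> \<Omega> E \<tau> \<phi> d\<phi> t = E (\<phi> t)"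
  by (simp add: nonlocal_energy_def)

lemma nonlocal_energy_second:
  "t \<in> {\<tau> 1..\<tau> 2} \<Longrightarrow>
     nonlocal_energy \<alpha> \<Omega> E \<tau> \<phi> d\<phi> t = E (\<phi> t) + F_hist \<alpha> \<Omega> d\<phi> (\<tau> 1) t"
  by (cases "t = \<tau> 1") (auto simp: nonlocal_energy_def)

lemma nonlocal_energy_later:
  assumes n: "2 \<le> n" "n < M" and t: "t \<in> {\<tau> n..\<tau> (n + 1)}"
  shows "nonlocal_energy \<alpha> \<Omega> E \<tau> \<phi> d\<phi> t =
    E (\<phi> t) + F_hist \<alpha> \<Omega> d\<phi> (\<tau> n) t + (\<Sum>k=1..n-1. F_hist \<alpha> \<Omega> d\<phi> (\<tau> k) (\<tau> (k + 1)))"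
proof -
  have gt1: "\<tau> 1 < \<tau> n" using n by (intro time_mesh_less) auto
  have ge2: "\<tau> 2 \<le> \<tau> n" using n by (intro time_mesh_le) auto
  show ?thesis
  proof (cases "t = \<tau> n")
    case False
    then have lt: "\<tau> n < t" using t by auto
    have L: "(LEAST n. t \<le> \<tau> (n + 1)) = n" using n t lt by (intro time_mesh_index) auto
    show ?thesis
      unfolding nonlocal_energy_def Let_def L using lt gt1 ge2 by simp
  next
    case True
    obtain m where m: "n = Suc m" "1 \<le> m" using n by (cases n) auto
    show ?thesis
    proof (cases "m = 1")
      case True
      then have "n = 2" using m by simp
      then show ?thesis
        using gt1 \<open>t = \<tau> n\<close> by (simp add: nonlocal_energy_def numeral_2_eq_2)
    next
      case False
      then have "2 \<le> m" using m by simp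
      have lt: "\<tau> m < \<tau> n" "\<tau> 2 < \<tau> n"
        using m n \<open>2 \<le> m\<close> by (auto intro: time_mesh_less)
      have L: "(LEAST n. t \<le> \<tau> (n + 1)) = m"
        using m n lt \<open>t = \<tau> n\<close> by (intro time_mesh_index) auto
      have S: "(\<Sum>k=1..n-1. F_hist \<alpha> \<Omega> d\<phi> (\<tau> k) (\<tau> (k + 1))) =
          (\<Sum>k=1..m-1. F_hist \<alpha> \<Omega> d\<phi> (\<tau> k) (\<tau> (k + 1))) + F_hist \<alpha> \<Omega> d\<phi> (\<tau> m) (\<tau> n)"
        using m \<open>2 \<le> m\<close> by (cases m) auto
      show ?thesis
        unfolding nonlocal_energy_def Let_def L S using lt gt1 \<open>t = \<tau> n\<close> by simp
    qed
  qed
qed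

end

end

theory Submission
  imports Defs
begin

text \<open>
  On a mesh interval from \<open>a = \<tau> n\<close> to \<open>b = \<tau> (n + 1)\<close> the chain rule and the equation give
  \<open>d/ds E(\<phi> s) = - (D\<^sup>\<alpha> \<phi>, \<partial>\<^sub>s\<phi>)\<close> for almost every \<open>s\<close>, where \<open>D\<^sup>\<alpha>\<close> is the Caputo derivative. The
  memory integral in \<open>D\<^sup>\<alpha> \<phi> (s)\<close> runs over \<open>\<sigma>\<close> from 0 to \<open>s\<close>; cutting it at \<open>\<sigma> = a\<close> and
  integrating over \<open>s\<close> turns the old part into \<open>F_hist a b\<close> and the recent part into the integral
  of \<open>A_form a b\<close> (\<open>energy_balance\<close>). The non-local energy is built so that its increment over
  the interval is the increment of \<open>E\<close> plus \<open>F_hist a b\<close>, so the history term cancels and only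
  minus the quadratic form remains.

  Three facts carry this. First, an absolutely continuous function is the integral of its
  almost-everywhere derivative (\<open>fundamental_theorem_of_calculus_abs_continuous\<close>). Second, the
  density \<open>(s - \<sigma>)\<^bsup>-\<alpha>\<^esup> \<partial>\<^sub>t\<phi>(\<sigma>, x) \<partial>\<^sub>t\<phi>(s, x)\<close> is integrable over all three variables
  (\<open>integrable_memory_density\<close>), because the singularity is integrable and
  \<open>\<bar>f(\<sigma>) f(s)\<bar> \<le> f(\<sigma>)\<^sup>2 + f(s)\<^sup>2\<close>; this justifies every exchange of the order of integration
  between space and time. Third, the quadratic form is nonnegative
  (\<open>one_sided_power_form_nonneg\<close>): up to a positive constant, \<open>\<bar>s - \<sigma>\<bar>\<^bsup>-\<alpha>\<^esup>\<close> is the integral over \<open>u\<close>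
  of the product of the one-sided powers \<open>(s - u)\<^bsup>-\<beta>\<^esup>\<close> and \<open>(\<sigma> - u)\<^bsup>-\<beta>\<^esup>\<close> with
  \<open>\<beta> = (1 + \<alpha>) / 2\<close>, so the form is an integral of squares.
\<close>

section \<open>The fundamental theorem of calculus for absolutely continuous functions\<close>

text \<open>
  The definition enumerates its intervals by an initial segment of the naturals. A tagged division
  is a set of pairs, so the condition is needed for an arbitrary finite index set.
\<close>

lemma abs_continuous_on_interval_finite_family:
  assumes "abs_continuous_on_interval a b f" "0 < \<epsilon>"
  shows "\<exists>\<delta>>0. \<forall>(I :: 'i set) l r. finite I \<longrightarrow> (\<forall>i\<in>I. a \<le> l i \<and> l i \<le> r i \<and> r i \<le> b) \<longrightarrow>
       disjoint_family_on (\<lambda>i. {l i<..<r i}) I \<longrightarrow> (\<Sum>i\<in>I. r i - l i) < \<delta> \<longrightarrow>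
       (\<Sum>i\<in>I. \<bar>f (r i) - f (l i)\<bar>) < \<epsilon>"
proof -
  obtain \<delta> where \<delta>: "0 < \<delta>" and ac: "\<forall>(n::nat) l r.
      (\<forall>i<n. a \<le> l i \<and> l i \<le> r i \<and> r i \<le> b) \<longrightarrow>
      disjoint_family_on (\<lambda>i. {l i<..<r i}) {..<n} \<longrightarrow>
      (\<Sum>i<n. r i - l i) < \<delta> \<longrightarrow> (\<Sum>i<n. \<bar>f (r i) - f (l i)\<bar>) < \<epsilon>"
    using assms unfolding abs_continuous_on_interval_def by auto
  have "(\<Sum>i\<in>I. \<bar>f (r i) - f (l i)\<bar>) < \<epsilon>"
    if fin: "finite I" and lr: "\<And>i. i \<in> I \<Longrightarrow> a \<le> l i \<and> l i \<le> r i \<and> r i \<le> b"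
      and disj: "disjoint_family_on (\<lambda>i. {l i<..<r i}) I" and le: "(\<Sum>i\<in>I. r i - l i) < \<delta>"
    for I :: "'i set" and l r
  proof -
    obtain h where h: "bij_betw h {..<card I} I"
      using ex_bij_betw_nat_finite[OF fin] by (auto simp: atLeast0LessThan)
    have S: "(\<Sum>i\<in>I. F i) = (\<Sum>i<card I. F (h i))" for F :: "'i \<Rightarrow> real"
      by (rule sum.reindex_bij_betw[OF h, symmetric])
    have hI: "h i \<in> I" if "i < card I" for i
      using h that by (auto simp: bij_betw_def)
    have "disjoint_family_on (\<lambda>i. {l (h i)<..<r (h i)}) {..<card I}"
      unfolding disjoint_family_on_def
    proof (intro ballI impI)
      fix i j assume "i \<in> {..<card I}" "j \<in> {..<card I}" "i \<noteq> j"
      then have "h i \<in> I" "h j \<in> I" "h i \<noteq> h j"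
        using h by (auto simp: bij_betw_def inj_on_def)
      then show "{l (h i)<..<r (h i)} \<inter> {l (h j)<..<r (h j)} = {}"
        using disj unfolding disjoint_family_on_def by blast
    qed
    then show ?thesis
      using ac[rule_format, of "card I" "l \<circ> h" "r \<circ> h"] lr[OF hI] le by (simp add: S)
  qed
  with \<delta> show ?thesis by (intro exI[of _ \<delta>]) simp
qed

text \<open>
  The exceptional null set \<open>N\<close> is why differentiability alone does not suffice. The
  Henstock-Kurzweil integral handles it through the choice of gauge: at a tag outside \<open>N\<close> the gauge
  is a ball on which \<open>f\<close> is close to its linear part, and at a tag in \<open>N\<close> it is one fixed open set
  \<open>U\<close> around \<open>N\<close> of tiny measure. The intervals tagged in \<open>N\<close> then have tiny total length, and
  absolute continuity makes the total increment of \<open>f\<close> over them small.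
\<close>

theorem fundamental_theorem_of_calculus_abs_continuous:
  assumes ac: "abs_continuous_on_interval A B f"
    and sub: "A \<le> a" "a \<le> b" "b \<le> B"
    and deriv: "AE t\<in>{a<..<b} in lborel. (f has_real_derivative g t) (at t)"
  shows "(g has_integral f b - f a) {a..b}"
proof -
  obtain N0 where N0: "N0 \<in> null_sets lborel"
      and dN0: "\<And>t. t \<in> {a<..<b} \<Longrightarrow> t \<notin> N0 \<Longrightarrow> (f has_real_derivative g t) (at t)"
    using deriv by (auto elim!: AE_E3 simp: space_lborel)
  define N where "N = N0 \<union> {a, b}"
  have N: "N \<in> null_sets lebesgue"
    unfolding N_def using N0 by (auto intro!: null_sets.Un null_sets_completionI finite_imp_null_set_lborel)
  have dN: "(f has_real_derivative g t) (at t)" if "t \<in> {a..b}" "t \<notin> N" for t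
    using dN0[of t] that by (auto simp: N_def)
  \<comment> \<open>The integrand is set to 0 on \<open>N\<close>, so that there only the increments of \<open>f\<close> contribute an error.\<close>
  define g0 where "g0 t = (if t \<in> N then 0 else g t)" for t
  have "(g0 has_integral f b - f a) {a..b}"
    unfolding has_integral_real
  proof (intro allI impI)
    fix e :: real assume e: "0 < e"
    define e1 where "e1 = e / (2 * (b - a + 1))"
    have e1: "0 < e1" "e1 * (b - a) < e / 2"
      using e sub by (auto simp: e1_def divide_simps)
    obtain \<delta> where \<delta>: "0 < \<delta>" and ac': "\<forall>(I :: (real \<times> real set) set) l r.
       finite I \<longrightarrow> (\<forall>i\<in>I. A \<le> l i \<and> l i \<le> r i \<and> r i \<le> B) \<longrightarrow>
       disjoint_family_on (\<lambda>i. {l i<..<r i}) I \<longrightarrow> (\<Sum>i\<in>I. r i - l i) < \<delta> \<longrightarrow>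
       (\<Sum>i\<in>I. \<bar>f (r i) - f (l i)\<bar>) < e / 2"
      using abs_continuous_on_interval_finite_family[OF ac half_gt_zero[OF e],
          where 'i = "real \<times> real set"] by (elim exE conjE)
    obtain U where U: "open U" "N \<subseteq> U" and mU: "U \<in> lmeasurable" "measure lebesgue U < \<delta>"
    proof -
      obtain U where U: "open U" "N \<subseteq> U" "U - N \<in> lmeasurable"
          "emeasure lebesgue (U - N) < ennreal \<delta>"
        using sets_lebesgue_outer_open[of N \<delta>] N \<delta> by auto
      have "emeasure lebesgue U = emeasure lebesgue (U - N)"
        using N U(1) by (simp add: emeasure_Diff_null_set)
      then have lt: "emeasure lebesgue U < ennreal \<delta>" using U(4) by simp
      then have "U \<in> lmeasurable" using U(1)
        by (intro fmeasurableI) (auto intro: less_trans)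
      moreover have "measure lebesgue U < \<delta>"
        using lt \<delta> by (cases "emeasure lebesgue U") (auto simp: measure_def ennreal_less_iff)
      ultimately show thesis using that U by blast
    qed
    have "\<exists>d>0. x \<in> {a..b} - N \<longrightarrow> (\<forall>y. \<bar>y - x\<bar> < d \<longrightarrow> \<bar>f y - f x - g x * (y - x)\<bar> \<le> e1 * \<bar>y - x\<bar>)" for x
    proof (cases "x \<in> {a..b} - N")
      case True
      then have "(f has_derivative (*) (g x)) (at x)"
        using dN[of x] by (simp add: has_field_derivative_def)
      then show ?thesis
        using e1(1) unfolding has_derivative_at_alt by (auto simp: real_norm_def)
    qed (auto intro: exI[of _ 1])
    then obtain d where d: "\<And>x. 0 < d x" and
      dbound: "\<And>x y. x \<in> {a..b} - N \<Longrightarrow> \<bar>y - x\<bar> < d x \<Longrightarrow> \<bar>f y - f x - g x * (y - x)\<bar> \<le> e1 * \<bar>y - x\<bar>"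
      by metis
    define \<gamma> where "\<gamma> x = (if x \<in> N then U else ball x (d x))" for x
    have G: "gauge \<gamma>"
      using U d by (auto simp: gauge_def \<gamma>_def)
    have small: "norm ((\<Sum>(x,K)\<in>p. measure lborel K *\<^sub>R g0 x) - (f b - f a)) < e"
      if p: "p tagged_division_of {a..b}" and fine: "\<gamma> fine p" for p
    proof -
      have fin: "finite p" using p by blast
      define l where "l = (\<lambda>z :: real \<times> real set. Inf (snd z))"
      define r where "r = (\<lambda>z :: real \<times> real set. Sup (snd z))"
      have int: "K = {l (x, K)..r (x, K)}" "l (x, K) \<le> x" "x \<le> r (x, K)"
          "a \<le> l (x, K)" "r (x, K) \<le> b" if xK: "(x, K) \<in> p" for x K
      proof -
        obtain u v where uv: "K = {u..v}" using p xK by (metis tagged_division_ofD(4) cbox_interval)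
        have "x \<in> K" "K \<subseteq> {a..b}" using p xK by blast+
        with uv show "K = {l (x, K)..r (x, K)}" "l (x, K) \<le> x" "x \<le> r (x, K)"
          "a \<le> l (x, K)" "r (x, K) \<le> b" by (auto simp: l_def r_def)
      qed
      define err where "err = (\<lambda>z. (r z - l z) * g0 (fst z) - (f (r z) - f (l z)))"
      define p1 where "p1 = {z \<in> p. fst z \<in> N}"
      define p2 where "p2 = {z \<in> p. fst z \<notin> N}"
      have p12: "p = p1 \<union> p2" "p1 \<inter> p2 = {}" "finite p1" "finite p2"
        using fin by (auto simp: p1_def p2_def)
      have cont: "measure lborel K = r (x, K) - l (x, K)" if "(x, K) \<in> p" for x K
        using int[OF that] content_real by (metis order_trans)
      have ba: "b - a = (\<Sum>z\<in>p. r z - l z)" "f b - f a = (\<Sum>z\<in>p. f (r z) - f (l z))"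
        using additive_tagged_division_1[OF sub(2) p, of "\<lambda>x. x"]
          additive_tagged_division_1[OF sub(2) p, of f]
        by (auto simp: l_def r_def case_prod_beta)
      have "(\<Sum>(x,K)\<in>p. measure lborel K *\<^sub>R g0 x) = (\<Sum>z\<in>p. (r z - l z) * g0 (fst z))"
        by (intro sum.cong) (auto simp: cont)
      then have "(\<Sum>(x,K)\<in>p. measure lborel K *\<^sub>R g0 x) - (f b - f a) = sum err p"
        by (simp add: ba err_def sum_subtractf)
      also have "\<dots> = sum err p1 + sum err p2"
        using p12 by (metis sum.union_disjoint)
      finally have split: "(\<Sum>(x,K)\<in>p. measure lborel K *\<^sub>R g0 x) - (f b - f a) = sum err p1 + sum err p2" .
      \<comment> \<open>Tags outside \<open>N\<close>: the error is at most \<open>e1\<close> times the length of the interval.\<close>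
      have "\<bar>sum err p2\<bar> \<le> (\<Sum>z\<in>p2. e1 * (r z - l z))"
      proof (rule order_trans[OF sum_abs], rule sum_mono)
        fix z assume z: "z \<in> p2"
        obtain x K where xK: "z = (x, K)" by (cases z)
        have zp: "(x, K) \<in> p" and xN: "x \<notin> N" using z xK by (auto simp: p2_def)
        note i = int[OF zp]
        have "K \<subseteq> ball x (d x)" using fineD[OF fine zp] xN by (simp add: \<gamma>_def)
        then have lr: "l z \<in> ball x (d x)" "r z \<in> ball x (d x)"
          using i xK by (metis atLeastAtMost_iff order_refl order_trans subsetD)+
        have x: "x \<in> {a..b} - N" using i xN by auto
        have "\<bar>f (l z) - f x - g x * (l z - x)\<bar> \<le> e1 * (x - l z)"
          using dbound[OF x, of "l z"] lr i xK by (auto simp: dist_real_def)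
        moreover have "\<bar>f (r z) - f x - g x * (r z - x)\<bar> \<le> e1 * (r z - x)"
          using dbound[OF x, of "r z"] lr i xK by (auto simp: dist_real_def)
        moreover have "err z = (f (l z) - f x - g x * (l z - x)) - (f (r z) - f x - g x * (r z - x))"
          using xK xN by (simp add: err_def g0_def algebra_simps)
        ultimately show "\<bar>err z\<bar> \<le> e1 * (r z - l z)"
          by (simp add: algebra_simps abs_le_iff)
      qed
      also have "\<dots> \<le> (\<Sum>z\<in>p. e1 * (r z - l z))"
      proof (rule sum_mono2[OF fin])
        show "0 \<le> e1 * (r z - l z)" if "z \<in> p - p2" for z
        proof -
          have "(fst z, snd z) \<in> p" using that by simp
          from int(2,3)[OF this] have "l z \<le> r z" by simp
          then show ?thesis using e1 by simp
        qed
      qed (auto simp: p2_def)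
      also have "\<dots> = e1 * (b - a)" by (simp add: ba sum_distrib_left)
      finally have err2: "\<bar>sum err p2\<bar> < e / 2" using e1 by linarith
      \<comment> \<open>Tags in \<open>N\<close>: the open intervals are disjoint subsets of \<open>U\<close>, so absolute continuity applies.\<close>
      have disj: "disjoint_family_on (\<lambda>z. {l z<..<r z}) p1"
        unfolding disjoint_family_on_def
      proof (intro ballI impI)
        fix z w assume zw: "z \<in> p1" "w \<in> p1" "z \<noteq> w"
        obtain x K y L where [simp]: "z = (x, K)" "w = (y, L)" by (cases z, cases w)
        have "(x, K) \<in> p" "(y, L) \<in> p" using zw by (auto simp: p1_def)
        moreover from this have "interior K \<inter> interior L = {}"
          using zw by (intro tagged_division_ofD(5)[OF p]) auto
        ultimately show "{l z<..<r z} \<inter> {l w<..<r w} = {}"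
          using int(1)[of x K] int(1)[of y L] by (metis \<open>z = (x, K)\<close> \<open>w = (y, L)\<close> interior_atLeastAtMost_real)
      qed
      have lr: "l z \<le> r z" "A \<le> l z" "r z \<le> B" "{l z<..<r z} \<subseteq> U" if "z \<in> p1" for z
      proof -
        obtain x K where xK: "z = (x, K)" by (cases z)
        have zp: "(x, K) \<in> p" and xN: "x \<in> N" using that xK by (auto simp: p1_def)
        have "K \<subseteq> U" using fineD[OF fine zp] xN by (simp add: \<gamma>_def)
        then have "{l z..r z} \<subseteq> U" using int(1)[OF zp] xK by simp
        then show "{l z<..<r z} \<subseteq> U" by (rule order_trans[rotated]) auto
        show "l z \<le> r z" "A \<le> l z" "r z \<le> B" using int[OF zp] sub xK by auto
      qed
      have "(\<Sum>z\<in>p1. r z - l z) = (\<Sum>z\<in>p1. measure lebesgue {l z<..<r z})"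
        by (intro sum.cong) (auto simp: lr)
      also have "\<dots> = measure lebesgue (\<Union>z\<in>p1. {l z<..<r z})"
        using disj p12 by (intro measure_finite_Union[symmetric]) (auto simp: lr)
      also have "\<dots> \<le> measure lebesgue U"
        using mU(1) lr(4) p12(3) by (intro measure_mono_fmeasurable UN_least) auto
      finally have "(\<Sum>z\<in>p1. r z - l z) < \<delta>" using mU by linarith
      then have "(\<Sum>z\<in>p1. \<bar>f (r z) - f (l z)\<bar>) < e / 2"
        using lr disj p12 by (intro ac'[rule_format]) auto
      moreover have "\<bar>sum err p1\<bar> \<le> (\<Sum>z\<in>p1. \<bar>f (r z) - f (l z)\<bar>)"
        by (rule order_trans[OF sum_abs], rule sum_mono) (auto simp: p1_def err_def g0_def)
      ultimately show ?thesis using split err2 by simp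
    qed
    show "\<exists>\<gamma>. gauge \<gamma> \<and> (\<forall>p. p tagged_division_of {a..b} \<and> \<gamma> fine p \<longrightarrow>
        norm ((\<Sum>(x,K)\<in>p. measure lborel K *\<^sub>R g0 x) - (f b - f a)) < e)"
    proof (intro exI conjI allI impI)
      show "gauge \<gamma>" by (fact G)
    qed (elim conjE, rule small)
  qed
  moreover have "negligible N" using N by (simp add: negligible_iff_null_sets)
  ultimately show ?thesis
    by (rule has_integral_spike[rotated 2]) (auto simp: g0_def)
qed

section \<open>Weakly singular kernels\<close>

text \<open>
  The convolution kernel of the fractional integral: the power is extended by 0 to the nonpositive
  half-line, so that causality (only \<open>\<sigma> < s\<close> contributes at time \<open>s\<close>) is part of the kernel and
  integrals over \<open>\<sigma> \<le> s\<close> become integrals over the whole line.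
\<close>

definition one_sided_power :: "real \<Rightarrow> real \<Rightarrow> real" where
  "one_sided_power \<alpha> h = (if 0 < h then h powr (-\<alpha>) else 0)"

lemma one_sided_power_nonneg [simp]: "0 \<le> one_sided_power \<alpha> h"
  by (simp add: one_sided_power_def)

lemma borel_measurable_one_sided_power [measurable]: "one_sided_power \<alpha> \<in> borel_measurable borel"
  unfolding one_sided_power_def[abs_def] by measurable

lemma nn_integral_one_sided_power_window:
  assumes \<alpha>: "\<alpha> < 1" and T: "0 \<le> T"
  shows "(\<integral>\<^sup>+h. ennreal (one_sided_power \<alpha> h) * indicator {..T} h \<partial>lborel)
    = ennreal (T powr (1 - \<alpha>) / (1 - \<alpha>))"
proof -
  have "((\<lambda>h. h powr (-\<alpha>)) has_integral T powr (1 - \<alpha>) / (1 - \<alpha>)) {0..T}"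
    using has_integral_powr_from_0[of "-\<alpha>" T] \<alpha> T by simp
  then have "(\<integral>\<^sup>+h. ennreal (h powr (-\<alpha>)) * indicator {0..T} h \<partial>lborel) = ennreal (T powr (1 - \<alpha>) / (1 - \<alpha>))"
    by (intro nn_integral_has_integral_lebesgue') auto
  also have "(\<lambda>h. ennreal (h powr (-\<alpha>)) * indicator {0..T} h) =
      (\<lambda>h. ennreal (one_sided_power \<alpha> h) * indicator {..T} h)"
    by (auto simp: fun_eq_iff one_sided_power_def indicator_def)
  finally show ?thesis .
qed

lemma nn_integral_one_sided_power_forward:
  assumes \<alpha>: "\<alpha> < 1" and s: "0 < s" "s < T"
  shows "(\<integral>\<^sup>+\<sigma>. ennreal (one_sided_power \<alpha> (\<sigma> - s)) * indicator {0<..<T} \<sigma> \<partial>lborel)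
     \<le> ennreal (T powr (1 - \<alpha>) / (1 - \<alpha>))"
proof -
  have "(\<integral>\<^sup>+\<sigma>. ennreal (one_sided_power \<alpha> (\<sigma> - s)) * indicator {0<..<T} \<sigma> \<partial>lborel)
      = (\<integral>\<^sup>+h. ennreal (one_sided_power \<alpha> h) * indicator {0<..<T} (s + h) \<partial>lborel)"
    by (subst nn_integral_real_affine[of _ 1 s]) auto
  also have "\<dots> \<le> (\<integral>\<^sup>+h. ennreal (one_sided_power \<alpha> h) * indicator {..T} h \<partial>lborel)"
    using s by (intro nn_integral_mono) (auto simp: indicator_def)
  finally show ?thesis using nn_integral_one_sided_power_window[OF \<alpha>, of T] s by simp
qed

lemma nn_integral_one_sided_power_backward:
  assumes \<alpha>: "\<alpha> < 1" and s: "0 < s" "s < T"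
  shows "(\<integral>\<^sup>+\<sigma>. ennreal (one_sided_power \<alpha> (s - \<sigma>)) * indicator {0<..<T} \<sigma> \<partial>lborel)
     \<le> ennreal (T powr (1 - \<alpha>) / (1 - \<alpha>))"
proof -
  have "(\<integral>\<^sup>+\<sigma>. ennreal (one_sided_power \<alpha> (s - \<sigma>)) * indicator {0<..<T} \<sigma> \<partial>lborel)
      = (\<integral>\<^sup>+h. ennreal (one_sided_power \<alpha> h) * indicator {0<..<T} (s - h) \<partial>lborel)"
    by (subst nn_integral_real_affine[of _ "-1" s]) auto
  also have "\<dots> \<le> (\<integral>\<^sup>+h. ennreal (one_sided_power \<alpha> h) * indicator {..T} h \<partial>lborel)"
    using s by (intro nn_integral_mono) (auto simp: indicator_def)
  finally show ?thesis using nn_integral_one_sided_power_window[OF \<alpha>, of T] s by simp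
qed

text \<open>
  Schur's test in its simplest form: \<open>\<bar>f(\<sigma>) f(s)\<bar> \<le> f(\<sigma>)\<^sup>2 + f(s)\<^sup>2\<close> separates the two factors, and
  in each of the two resulting integrals the kernel is integrated over the variable that the square
  does not involve, over a window of length at most \<open>T\<close>.
\<close>

lemma nn_integral_one_sided_power_form_le:
  fixes f :: "real \<Rightarrow> real"
  assumes \<alpha>: "\<alpha> < 1" and [measurable]: "f \<in> borel_measurable borel"
    and supp: "\<And>s. s \<notin> {0<..<T} \<Longrightarrow> f s = 0"
  shows "(\<integral>\<^sup>+s. \<integral>\<^sup>+\<sigma>. ennreal \<bar>one_sided_power \<alpha> (s - \<sigma>) * f \<sigma> * f s\<bar> \<partial>lborel \<partial>lborel)
    \<le> 2 * ennreal (T powr (1 - \<alpha>) / (1 - \<alpha>)) * (\<integral>\<^sup>+s. ennreal ((f s)\<^sup>2) \<partial>lborel)"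
proof -
  let ?w = "one_sided_power \<alpha>" and ?I = "indicator {0<..<T} :: real \<Rightarrow> ennreal"
  let ?W = "ennreal (T powr (1 - \<alpha>) / (1 - \<alpha>))" and ?F = "\<lambda>s. ennreal ((f s)\<^sup>2)"
  have pt: "ennreal \<bar>?w (s - \<sigma>) * f \<sigma> * f s\<bar> \<le>
      ?F s * (ennreal (?w (s - \<sigma>)) * ?I \<sigma>) + ?F \<sigma> * (ennreal (?w (s - \<sigma>)) * ?I s)" for s \<sigma>
  proof (cases "s \<in> {0<..<T} \<and> \<sigma> \<in> {0<..<T}")
    case True
    have "2 * (\<bar>f \<sigma>\<bar> * \<bar>f s\<bar>) \<le> (f \<sigma>)\<^sup>2 + (f s)\<^sup>2"
      using sum_squares_bound[of "\<bar>f \<sigma>\<bar>" "\<bar>f s\<bar>"] by simp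
    moreover have "0 \<le> \<bar>f \<sigma>\<bar> * \<bar>f s\<bar>" by simp
    ultimately have "\<bar>f \<sigma>\<bar> * \<bar>f s\<bar> \<le> (f s)\<^sup>2 + (f \<sigma>)\<^sup>2" by linarith
    then have "?w (s - \<sigma>) * (\<bar>f \<sigma>\<bar> * \<bar>f s\<bar>) \<le> ?w (s - \<sigma>) * ((f s)\<^sup>2 + (f \<sigma>)\<^sup>2)"
      by (rule mult_left_mono) simp
    then have "ennreal \<bar>?w (s - \<sigma>) * f \<sigma> * f s\<bar> \<le> ennreal ((f s)\<^sup>2 * ?w (s - \<sigma>) + (f \<sigma>)\<^sup>2 * ?w (s - \<sigma>))"
      by (intro ennreal_leI) (simp add: abs_mult algebra_simps)
    also have "\<dots> = ?F s * (ennreal (?w (s - \<sigma>)) * ?I \<sigma>) + ?F \<sigma> * (ennreal (?w (s - \<sigma>)) * ?I s)"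
      using True by (simp add: ennreal_mult)
    finally show ?thesis .
  next
    case False
    then have "f s = 0 \<or> f \<sigma> = 0" using supp by blast
    then show ?thesis by auto
  qed
  have "(\<integral>\<^sup>+s. \<integral>\<^sup>+\<sigma>. ennreal \<bar>?w (s - \<sigma>) * f \<sigma> * f s\<bar> \<partial>lborel \<partial>lborel) \<le>
     (\<integral>\<^sup>+s. \<integral>\<^sup>+\<sigma>. ?F s * (ennreal (?w (s - \<sigma>)) * ?I \<sigma>) + ?F \<sigma> * (ennreal (?w (s - \<sigma>)) * ?I s) \<partial>lborel \<partial>lborel)"
    by (intro nn_integral_mono pt)
  also have "\<dots> = (\<integral>\<^sup>+s. \<integral>\<^sup>+\<sigma>. ?F s * (ennreal (?w (s - \<sigma>)) * ?I \<sigma>) \<partial>lborel \<partial>lborel) +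
      (\<integral>\<^sup>+s. \<integral>\<^sup>+\<sigma>. ?F \<sigma> * (ennreal (?w (s - \<sigma>)) * ?I s) \<partial>lborel \<partial>lborel)"
    by (simp add: nn_integral_add)
  also have "(\<integral>\<^sup>+s. \<integral>\<^sup>+\<sigma>. ?F \<sigma> * (ennreal (?w (s - \<sigma>)) * ?I s) \<partial>lborel \<partial>lborel) =
      (\<integral>\<^sup>+\<sigma>. \<integral>\<^sup>+s. ?F \<sigma> * (ennreal (?w (s - \<sigma>)) * ?I s) \<partial>lborel \<partial>lborel)"
    by (rule lborel_pair.Fubini') measurable
  also have "(\<integral>\<^sup>+s. \<integral>\<^sup>+\<sigma>. ?F s * (ennreal (?w (s - \<sigma>)) * ?I \<sigma>) \<partial>lborel \<partial>lborel) =
      (\<integral>\<^sup>+s. ?F s * (\<integral>\<^sup>+\<sigma>. ennreal (?w (s - \<sigma>)) * ?I \<sigma> \<partial>lborel) \<partial>lborel)"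
    by (simp add: nn_integral_cmult)
  also have "(\<integral>\<^sup>+\<sigma>. \<integral>\<^sup>+s. ?F \<sigma> * (ennreal (?w (s - \<sigma>)) * ?I s) \<partial>lborel \<partial>lborel) =
      (\<integral>\<^sup>+\<sigma>. ?F \<sigma> * (\<integral>\<^sup>+s. ennreal (?w (s - \<sigma>)) * ?I s \<partial>lborel) \<partial>lborel)"
    by (simp add: nn_integral_cmult)
  also have "(\<integral>\<^sup>+s. ?F s * (\<integral>\<^sup>+\<sigma>. ennreal (?w (s - \<sigma>)) * ?I \<sigma> \<partial>lborel) \<partial>lborel) \<le> (\<integral>\<^sup>+s. ?F s * ?W \<partial>lborel)"
  proof (rule nn_integral_mono)
    fix s show "?F s * (\<integral>\<^sup>+\<sigma>. ennreal (?w (s - \<sigma>)) * ?I \<sigma> \<partial>lborel) \<le> ?F s * ?W"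
      using nn_integral_one_sided_power_backward[OF \<alpha>, of s T] supp[of s]
      by (cases "s \<in> {0<..<T}") (auto intro: mult_left_mono)
  qed
  also have "(\<integral>\<^sup>+s. ?F s * (\<integral>\<^sup>+\<sigma>. ennreal (?w (\<sigma> - s)) * ?I \<sigma> \<partial>lborel) \<partial>lborel) \<le> (\<integral>\<^sup>+s. ?F s * ?W \<partial>lborel)"
  proof (rule nn_integral_mono)
    fix s show "?F s * (\<integral>\<^sup>+\<sigma>. ennreal (?w (\<sigma> - s)) * ?I \<sigma> \<partial>lborel) \<le> ?F s * ?W"
      using nn_integral_one_sided_power_forward[OF \<alpha>, of s T] supp[of s]
      by (cases "s \<in> {0<..<T}") (auto intro: mult_left_mono)
  qed
  finally show ?thesis
    by (simp add: add_mono nn_integral_multc mult_ac flip: mult_2)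
qed

lemma integrable_one_sided_power_form:
  fixes f :: "real \<Rightarrow> real"
  assumes \<alpha>: "\<alpha> < 1" and f [measurable]: "f \<in> borel_measurable borel"
    and supp: "\<And>s. s \<notin> {0<..<T} \<Longrightarrow> f s = 0" and L2: "integrable lborel (\<lambda>s. (f s)\<^sup>2)"
  shows "integrable (lborel \<Otimes>\<^sub>M lborel) (\<lambda>(s, \<sigma>). one_sided_power \<alpha> (s - \<sigma>) * f \<sigma> * f s)"
proof (rule integrableI_bounded)
  have "(\<integral>\<^sup>+z. ennreal (norm (case z of (s, \<sigma>) \<Rightarrow> one_sided_power \<alpha> (s - \<sigma>) * f \<sigma> * f s)) \<partial>(lborel \<Otimes>\<^sub>M lborel))
      = (\<integral>\<^sup>+s. \<integral>\<^sup>+\<sigma>. ennreal \<bar>one_sided_power \<alpha> (s - \<sigma>) * f \<sigma> * f s\<bar> \<partial>lborel \<partial>lborel)"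
    by (subst lborel.nn_integral_fst[symmetric]) auto
  also have "\<dots> \<le> 2 * ennreal (T powr (1 - \<alpha>) / (1 - \<alpha>)) * (\<integral>\<^sup>+s. ennreal ((f s)\<^sup>2) \<partial>lborel)"
    by (rule nn_integral_one_sided_power_form_le[OF \<alpha> f supp])
  also have "\<dots> < \<infinity>"
    using L2 by (simp add: nn_integral_eq_integral ennreal_mult_less_top)
  finally show "(\<integral>\<^sup>+z. ennreal (norm (case z of (s, \<sigma>) \<Rightarrow> one_sided_power \<alpha> (s - \<sigma>) * f \<sigma> * f s)) \<partial>(lborel \<Otimes>\<^sub>M lborel)) < \<infinity>" .
qed measurable

text \<open>
  The Beta value \<open>B(1 - \<beta>, 2 \<beta> - 1)\<close>, the factor by which the superposition of one-sided powers
  differs from a pure power of the distance. Being an \<open>ennreal\<close>, it is meaningful for all \<open>\<beta>\<close>.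
\<close>

definition riesz_const :: "real \<Rightarrow> ennreal" where
  "riesz_const \<beta> = (\<integral>\<^sup>+v. ennreal (one_sided_power \<beta> v * one_sided_power \<beta> (1 + v)) \<partial>lborel)"

text \<open>
  The condition \<open>\<beta> < 1\<close> gives convergence at 0, and \<open>2 \<beta> > 1\<close> convergence at infinity, where the
  integrand is at most \<open>v\<^bsup>-2\<beta>\<^esup>\<close>.
\<close>

lemma riesz_const_finite:
  assumes \<beta>: "1 / 2 < \<beta>" "\<beta> < 1"
  shows "riesz_const \<beta> < \<infinity>"
proof -
  let ?w = "one_sided_power \<beta>"
  have le: "ennreal (?w v * ?w (1 + v)) \<le> ennreal (?w v) * indicator {..1} v +
      ennreal (v powr (-2 * \<beta>)) * indicator {1..} v" for v
  proof -
    consider "v \<le> 0" | "0 < v" "v \<le> 1" | "1 < v" by linarith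
    then show ?thesis
    proof cases
      case 2
      have "(1 + v) powr (-\<beta>) \<le> 1"
        using 2 \<beta> powr_mono[of "-\<beta>" 0 "1 + v"] by simp
      then have "?w v * ?w (1 + v) \<le> ?w v"
        using 2 by (simp add: one_sided_power_def mult_left_le)
      then have "ennreal (?w v * ?w (1 + v)) \<le> ennreal (?w v)" by (rule ennreal_leI)
      then show ?thesis using 2 by (cases "v = 1") (auto simp: indicator_def intro: add_increasing2)
    next
      case 3
      have "(1 + v) powr (-\<beta>) \<le> v powr (-\<beta>)"
        using 3 \<beta> by (intro powr_mono2') auto
      then have "?w v * ?w (1 + v) \<le> v powr (-\<beta>) * v powr (-\<beta>)"
        using 3 by (simp add: one_sided_power_def mult_left_mono)
      also have "\<dots> = v powr (-2 * \<beta>)" by (simp flip: powr_add)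
      finally show ?thesis using 3 by (auto intro!: ennreal_leI)
    qed (auto simp: one_sided_power_def)
  qed
  have "((\<lambda>v. v powr (-2 * \<beta>)) has_integral - (1 powr (-2 * \<beta> + 1)) / (-2 * \<beta> + 1)) {1..}"
    using \<beta> by (intro has_integral_powr_to_inf) auto
  then have inf: "(\<integral>\<^sup>+v. ennreal (v powr (-2 * \<beta>)) * indicator {1..} v \<partial>lborel) < \<infinity>"
    by (subst nn_integral_has_integral_lebesgue') auto
  have "riesz_const \<beta> \<le> (\<integral>\<^sup>+v. ennreal (?w v) * indicator {..1} v +
      ennreal (v powr (-2 * \<beta>)) * indicator {1..} v \<partial>lborel)"
    unfolding riesz_const_def by (intro nn_integral_mono le)
  also have "\<dots> = (\<integral>\<^sup>+v. ennreal (?w v) * indicator {..1} v \<partial>lborel) +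
      (\<integral>\<^sup>+v. ennreal (v powr (-2 * \<beta>)) * indicator {1..} v \<partial>lborel)"
    by (rule nn_integral_add) auto
  also have "\<dots> < \<infinity>"
    using inf nn_integral_one_sided_power_window[of \<beta> 1] \<beta> by (simp add: ennreal_add_eq_top less_top)
  finally show ?thesis .
qed

lemma riesz_const_pos: "0 < riesz_const \<beta>"
proof (rule ccontr)
  let ?w = "one_sided_power \<beta>"
  assume "\<not> 0 < riesz_const \<beta>"
  then have "riesz_const \<beta> = 0" by (simp add: not_gr_zero)
  then have "AE v in lborel. ennreal (?w v * ?w (1 + v)) = 0"
    unfolding riesz_const_def by (subst (asm) nn_integral_0_iff_AE) simp_all
  then have "AE v in lborel. v \<notin> {0<..<1::real}"
    by eventually_elim (auto simp: one_sided_power_def ennreal_eq_0_iff mult_le_0_iff)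
  then have "{0<..<1::real} \<in> null_sets lborel" by (subst AE_iff_null_sets) auto
  then show False by (simp add: null_sets_def)
qed

text \<open>
  The substitution \<open>u = s - (t - s) v\<close> takes the distance \<open>t - s\<close> out of the integral by
  homogeneity.
\<close>

lemma nn_integral_one_sided_power_convolution_ordered:
  assumes st: "s < t"
  shows "(\<integral>\<^sup>+u. ennreal (one_sided_power \<beta> (s - u) * one_sided_power \<beta> (t - u)) \<partial>lborel)
    = riesz_const \<beta> * ennreal ((t - s) powr (1 - 2 * \<beta>))"
proof -
  let ?w = "one_sided_power \<beta>"
  define h where "h = t - s"
  have h: "0 < h" using st by (simp add: h_def)
  have scale: "?w (h * v) = h powr (-\<beta>) * ?w v" for v
    using h by (simp add: one_sided_power_def zero_less_mult_iff powr_mult)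
  have "(\<integral>\<^sup>+u. ennreal (?w (s - u) * ?w (t - u)) \<partial>lborel) =
      ennreal h * (\<integral>\<^sup>+v. ennreal (?w (s - (s + - h * v)) * ?w (t - (s + - h * v))) \<partial>lborel)"
    using h by (subst nn_integral_real_affine[of _ "-h" s]) auto
  also have "\<dots> = ennreal h * (\<integral>\<^sup>+v. ennreal (h powr (-2 * \<beta>)) * ennreal (?w v * ?w (1 + v)) \<partial>lborel)"
  proof -
    have "ennreal (?w (s - (s + - h * v)) * ?w (t - (s + - h * v))) =
        ennreal (h powr (-2 * \<beta>)) * ennreal (?w v * ?w (1 + v))" for v
    proof -
      have "s - (s + - h * v) = h * v" "t - (s + - h * v) = h * (1 + v)"
        by (simp_all add: h_def algebra_simps)
      moreover have "?w (h * v) * ?w (h * (1 + v)) = (h powr (-\<beta>) * h powr (-\<beta>)) * (?w v * ?w (1 + v))"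
        by (simp only: scale mult_ac)
      moreover have "h powr (-\<beta>) * h powr (-\<beta>) = h powr (-2 * \<beta>)" by (simp flip: powr_add)
      ultimately show ?thesis by (simp add: ennreal_mult)
    qed
    then show ?thesis by simp
  qed
  also have "\<dots> = (ennreal h * ennreal (h powr (-2 * \<beta>))) * riesz_const \<beta>"
    by (simp add: nn_integral_cmult riesz_const_def mult.assoc)
  also have "ennreal h * ennreal (h powr (-2 * \<beta>)) = ennreal (h powr (1 - 2 * \<beta>))"
    using h by (simp add: powr_diff powr_minus divide_inverse flip: ennreal_mult)
  finally show ?thesis by (simp add: h_def mult.commute)
qed

text \<open>
  The exponent \<open>\<beta> = (1 + \<alpha>) / 2\<close> is the one with \<open>1 - 2 \<beta> = - \<alpha>\<close>. The sum on the right is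
  \<open>\<bar>s - t\<bar>\<^bsup>-\<alpha>\<^esup>\<close>. The diagonal is excluded: there the left side is infinite and the right side 0.
\<close>

lemma nn_integral_one_sided_power_convolution:
  assumes "s \<noteq> t"
  shows "(\<integral>\<^sup>+u. ennreal (one_sided_power ((1 + \<alpha>) / 2) (s - u) * one_sided_power ((1 + \<alpha>) / 2) (t - u)) \<partial>lborel)
    = riesz_const ((1 + \<alpha>) / 2) * ennreal (one_sided_power \<alpha> (s - t) + one_sided_power \<alpha> (t - s))"
proof -
  have exponent: "1 - 2 * ((1 + \<alpha>) / 2) = - \<alpha>" by (simp add: field_simps)
  show ?thesis
  proof (cases "s < t")
    case True
    then show ?thesis
      using nn_integral_one_sided_power_convolution_ordered[OF True, of "(1 + \<alpha>) / 2", unfolded exponent]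
      by (simp add: one_sided_power_def[of \<alpha>])
  next
    case False
    then have "t < s" using assms by simp
    from nn_integral_one_sided_power_convolution_ordered[OF this, of "(1 + \<alpha>) / 2", unfolded exponent] this
    show ?thesis
      by (subst mult.commute) (simp add: one_sided_power_def[of \<alpha>])
  qed
qed

section \<open>Positivity of the fractional quadratic form\<close>

text \<open>
  Triple integrals are organised as one over a pair and then over the remaining real variable.
\<close>

interpretation pair_sigma_finite_pair_left: pair_sigma_finite
    "lborel \<Otimes>\<^sub>M lborel :: ('a::euclidean_space \<times> real) measure" "lborel :: real measure"
  unfolding lborel_prod by (rule lborel_pair.pair_sigma_finite_axioms)

text \<open>
  Twice the form is the integral of the symmetric kernel \<open>\<bar>s - t\<bar>\<^bsup>-\<alpha>\<^esup>\<close> against \<open>f(s) f(t)\<close>. Writing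
  this kernel as a superposition over \<open>u\<close> of products \<open>v(s - u) v(t - u)\<close> and exchanging the
  integrals leaves the integral over \<open>u\<close> of the square of \<open>\<integral> v(s - u) f(s) ds\<close>.
\<close>

lemma one_sided_power_form_nonneg:
  fixes f :: "real \<Rightarrow> real"
  assumes \<alpha>: "0 < \<alpha>" "\<alpha> < 1" and f [measurable]: "f \<in> borel_measurable borel"
    and supp: "\<And>s. s \<notin> {0<..<T} \<Longrightarrow> f s = 0" and L2: "integrable lborel (\<lambda>s. (f s)\<^sup>2)"
  shows "0 \<le> (LINT s|lborel. LINT \<sigma>|lborel. one_sided_power \<alpha> (s - \<sigma>) * f \<sigma> * f s)"
proof -
  let ?w = "one_sided_power \<alpha>" and ?v = "one_sided_power ((1 + \<alpha>) / 2)"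
  let ?C = "enn2real (riesz_const ((1 + \<alpha>) / 2))"
  let ?S = "\<lambda>(s, t). (?w (s - t) + ?w (t - s)) * (f s * f t)"
  let ?J = "\<lambda>z u. (?v (fst z - u) * f (fst z)) * (?v (snd z - u) * f (snd z))"
  have fin: "riesz_const ((1 + \<alpha>) / 2) < \<infinity>" using \<alpha> by (intro riesz_const_finite) auto
  have C: "riesz_const ((1 + \<alpha>) / 2) = ennreal ?C" "0 < ?C"
    using fin riesz_const_pos[of "(1 + \<alpha>) / 2"] by (simp_all add: enn2real_positive_iff)
  have K: "integrable (lborel \<Otimes>\<^sub>M lborel) (\<lambda>(s, \<sigma>). ?w (s - \<sigma>) * f \<sigma> * f s)"
    by (rule integrable_one_sided_power_form[OF \<alpha>(2) f supp L2])
  have K': "integrable (lborel \<Otimes>\<^sub>M lborel) (\<lambda>(s, \<sigma>). ?w (\<sigma> - s) * f s * f \<sigma>)"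
    using lborel_pair.integrable_product_swap[OF K] by (simp add: case_prod_beta')
  have K'_eq: "(LINT z|(lborel \<Otimes>\<^sub>M lborel). (\<lambda>(s, \<sigma>). ?w (\<sigma> - s) * f s * f \<sigma>) z) =
      (LINT z|(lborel \<Otimes>\<^sub>M lborel). (\<lambda>(s, \<sigma>). ?w (s - \<sigma>) * f \<sigma> * f s) z)"
    using lborel_pair.integral_product_swap[of "\<lambda>(s, \<sigma>). ?w (s - \<sigma>) * f \<sigma> * f s"]
    by (simp add: case_prod_beta')
  have S_split: "?S = (\<lambda>z. (\<lambda>(s, \<sigma>). ?w (s - \<sigma>) * f \<sigma> * f s) z + (\<lambda>(s, \<sigma>). ?w (\<sigma> - s) * f s * f \<sigma>) z)"
    by (auto simp: fun_eq_iff algebra_simps)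
  have S: "integrable (lborel \<Otimes>\<^sub>M lborel) ?S"
    unfolding S_split using K K' by (rule Bochner_Integration.integrable_add)
  have S_eq: "(LINT z|(lborel \<Otimes>\<^sub>M lborel). ?S z) = 2 * (LINT s|lborel. LINT \<sigma>|lborel. ?w (s - \<sigma>) * f \<sigma> * f s)"
    unfolding S_split Bochner_Integration.integral_add[OF K K'] K'_eq lborel_pair.integral_fst[OF K]
    by simp
  \<comment> \<open>The kernel identity fails on the diagonal, which is a null set of the plane.\<close>
  have off_diag: "AE z in lborel \<Otimes>\<^sub>M lborel. fst z \<noteq> (snd z :: real)"
  proof (rule lborel_pair.AE_pair_measure)
    show "AE s in lborel. AE t in lborel. fst (s, t) \<noteq> (snd (s, t) :: real)"
    proof (rule AE_I2)
      fix s :: real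
      show "AE t in lborel. fst (s, t) \<noteq> snd (s, t)"
        using AE_lborel_singleton[of s] by eventually_elim auto
    qed
  qed measurable
  have conv: "(\<integral>\<^sup>+u. ennreal \<bar>?J (s, t) u\<bar> \<partial>lborel) = ennreal (?C * \<bar>?S (s, t)\<bar>)" if "s \<noteq> t" for s t
  proof -
    have "(\<integral>\<^sup>+u. ennreal \<bar>?J (s, t) u\<bar> \<partial>lborel) =
        (\<integral>\<^sup>+u. ennreal \<bar>f s * f t\<bar> * ennreal (?v (s - u) * ?v (t - u)) \<partial>lborel)"
      by (intro nn_integral_cong) (simp add: abs_mult mult_ac flip: ennreal_mult)
    also have "\<dots> = ennreal \<bar>f s * f t\<bar> * (ennreal ?C * ennreal (?w (s - t) + ?w (t - s)))"
      by (simp add: nn_integral_cmult nn_integral_one_sided_power_convolution[OF that] flip: C(1))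
    also have "\<dots> = ennreal (\<bar>f s * f t\<bar> * (?C * (?w (s - t) + ?w (t - s))))"
      by (simp only: ennreal_mult[symmetric] abs_ge_zero enn2real_nonneg add_nonneg_nonneg
          one_sided_power_nonneg mult_nonneg_nonneg)
    also have "\<dots> = ennreal (?C * \<bar>?S (s, t)\<bar>)"
      by (simp add: abs_mult mult_ac)
    finally show ?thesis .
  qed
  have conv': "(LINT u|lborel. ?J (s, t) u) = ?C * ?S (s, t)" if "s \<noteq> t" for s t
  proof -
    have "(LINT u|lborel. ?v (s - u) * ?v (t - u)) = ?C * (?w (s - t) + ?w (t - s))"
      by (subst integral_eq_nn_integral)
        (simp_all add: nn_integral_one_sided_power_convolution[OF that] enn2real_mult
          del: ennreal_plus)
    moreover have "?J (s, t) = (\<lambda>u. (f s * f t) * (?v (s - u) * ?v (t - u)))"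
      by (simp add: fun_eq_iff mult_ac)
    ultimately show ?thesis by (simp add: mult_ac)
  qed
  have Jm: "(\<lambda>(z, u). ?J z u) \<in> borel_measurable ((lborel \<Otimes>\<^sub>M lborel) \<Otimes>\<^sub>M lborel)"
    by measurable
  have J: "integrable ((lborel \<Otimes>\<^sub>M lborel) \<Otimes>\<^sub>M lborel) (\<lambda>(z, u). ?J z u)"
  proof (rule integrableI_bounded[OF Jm])
    have "(\<integral>\<^sup>+p. ennreal (norm (case p of (z, u) \<Rightarrow> ?J z u)) \<partial>((lborel \<Otimes>\<^sub>M lborel) \<Otimes>\<^sub>M lborel)) =
        (\<integral>\<^sup>+z. \<integral>\<^sup>+u. ennreal \<bar>?J z u\<bar> \<partial>lborel \<partial>(lborel \<Otimes>\<^sub>M lborel))"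
      using Jm by (subst lborel.nn_integral_fst[symmetric]) auto
    also have "\<dots> = (\<integral>\<^sup>+z. ennreal (?C * norm (?S z)) \<partial>(lborel \<Otimes>\<^sub>M lborel))"
    proof (rule nn_integral_cong_AE)
      show "AE z in lborel \<Otimes>\<^sub>M lborel. (\<integral>\<^sup>+u. ennreal \<bar>?J z u\<bar> \<partial>lborel) = ennreal (?C * norm (?S z))"
        using off_diag by eventually_elim (use conv in auto)
    qed
    also have "\<dots> < \<infinity>"
      using integrable_norm[OF S, THEN integrable_mult_right[of ?C]]
      by (subst nn_integral_eq_integral) auto
    finally show "(\<integral>\<^sup>+p. ennreal (norm (case p of (z, u) \<Rightarrow> ?J z u)) \<partial>((lborel \<Otimes>\<^sub>M lborel) \<Otimes>\<^sub>M lborel)) < \<infinity>" .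
  qed
  have "?C * (LINT z|(lborel \<Otimes>\<^sub>M lborel). ?S z) = (LINT z|(lborel \<Otimes>\<^sub>M lborel). ?C * ?S z)"
    by simp
  also have "\<dots> = (LINT z|(lborel \<Otimes>\<^sub>M lborel). LINT u|lborel. ?J z u)"
  proof (rule integral_cong_AE)
    show "AE z in lborel \<Otimes>\<^sub>M lborel. ?C * ?S z = (LINT u|lborel. ?J z u)"
      using off_diag by eventually_elim (use conv' in auto)
  qed (use S in measurable)
  also have "\<dots> = (LINT u|lborel. LINT z|(lborel \<Otimes>\<^sub>M lborel). ?J z u)"
    by (rule pair_sigma_finite_pair_left.Fubini_integral[OF J, symmetric])
  also have "\<dots> \<ge> 0"
  proof (rule integral_nonneg_AE)
    show "AE u in lborel. 0 \<le> (LINT z|(lborel \<Otimes>\<^sub>M lborel). ?J z u)"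
      using pair_sigma_finite_pair_left.AE_integrable_snd[OF J]
    proof eventually_elim
      fix u assume "integrable (lborel \<Otimes>\<^sub>M lborel) (\<lambda>z. ?J z u)"
      then have "(LINT z|(lborel \<Otimes>\<^sub>M lborel). ?J z u) =
          (LINT s|lborel. LINT t|lborel. (?v (s - u) * f s) * (?v (t - u) * f t))"
        by (subst lborel_pair.integral_fst'[symmetric]) auto
      also have "\<dots> = (LINT s|lborel. ?v (s - u) * f s)\<^sup>2"
        by (simp add: power2_eq_square)
      finally show "0 \<le> (LINT z|(lborel \<Otimes>\<^sub>M lborel). ?J z u)" by simp
    qed
  qed
  finally show ?thesis using C(2) by (simp add: S_eq zero_le_mult_iff)
qed

section \<open>The memory density on space-time\<close>

text \<open>
  Up to the factor \<open>1 / \<Gamma>(1 - \<alpha>)\<close>, the power at time \<open>s\<close> and place \<open>x\<close> that is due to the rate of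
  change at the earlier time \<open>\<sigma>\<close>.
\<close>

definition memory_density :: "real \<Rightarrow> (real \<Rightarrow> 'a \<Rightarrow> real) \<Rightarrow> 'a \<Rightarrow> real \<Rightarrow> real \<Rightarrow> real" where
  "memory_density \<alpha> D x s \<sigma> = one_sided_power \<alpha> (s - \<sigma>) * D \<sigma> x * D s x"

text \<open>
  At time 0 there is no history; hence the first mesh interval carries no history energy.
\<close>

lemma history_derivative_from_start [simp]: "history_derivative \<alpha> 0 f t = 0"
proof -
  have "(LINT s:{0..0}|lborel. (t - s) powr (-\<alpha>) * f s) = (LINT s:{}|lborel. (t - s) powr (-\<alpha>) * f s)"
    by (rule set_integral_discrete_difference[where X = "{0}"]) auto
  then show ?thesis by (simp add: history_derivative_def set_lebesgue_integral_def)
qed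

text \<open>
  \<open>D\<close> stands for the time derivative extended by 0 from the space-time cylinder to the whole space.
  The extension allows Fubini's theorem on full Lebesgue measure, with all restrictions of the domain
  carried by \<open>D\<close> and the kernel.
\<close>

locale square_integrable_field =
  fixes \<alpha> T :: real and D :: "real \<Rightarrow> 'a::euclidean_space \<Rightarrow> real"
  assumes \<alpha>: "0 < \<alpha>" "\<alpha> < 1"
    and D_meas: "(\<lambda>(t, x). D t x) \<in> borel_measurable (lborel \<Otimes>\<^sub>M lborel)"
    and D_L2: "integrable (lborel \<Otimes>\<^sub>M lborel) (\<lambda>(t, x). (D t x)\<^sup>2)"
    and D_supp: "\<And>t x. t \<notin> {0<..<T} \<Longrightarrow> D t x = 0"
begin

lemma D_measurable [measurable (raw)]:
  assumes "f \<in> borel_measurable M" "g \<in> borel_measurable M"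
  shows "(\<lambda>z. D (f z) (g z)) \<in> borel_measurable M"
proof -
  have "(\<lambda>z. (f z, g z)) \<in> measurable M (lborel \<Otimes>\<^sub>M lborel)"
    using assms by simp
  from measurable_compose[OF this D_meas] show ?thesis by simp
qed

lemma memory_density_measurable [measurable (raw)]:
  assumes "f \<in> borel_measurable M" "g \<in> borel_measurable M" "h \<in> borel_measurable M"
  shows "(\<lambda>z. memory_density \<alpha> D (f z) (g z) (h z)) \<in> borel_measurable M"
  using assms unfolding memory_density_def by measurable

lemma AE_time_square_integrable: "AE x in lborel. integrable lborel (\<lambda>t. (D t x)\<^sup>2)"
  using lborel_pair.AE_integrable_snd[OF D_L2] .

text \<open>
  For fixed \<open>x\<close> the integral over both times is bounded by a constant times the square integral of
  \<open>D\<close> in time, by Schur's test; integrating over \<open>x\<close> gives the square norm of \<open>D\<close> on space-time.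
\<close>

lemma integrable_memory_density:
  "integrable ((lborel \<Otimes>\<^sub>M lborel) \<Otimes>\<^sub>M lborel) (\<lambda>(z, \<sigma>). memory_density \<alpha> D (fst z) (snd z) \<sigma>)"
proof (rule integrableI_bounded)
  let ?P = "\<lambda>x s \<sigma>. ennreal \<bar>memory_density \<alpha> D x s \<sigma>\<bar>"
  let ?W = "2 * ennreal (T powr (1 - \<alpha>) / (1 - \<alpha>))"
  have "(\<integral>\<^sup>+p. ennreal (norm (case p of (z, \<sigma>) \<Rightarrow> memory_density \<alpha> D (fst z) (snd z) \<sigma>))
        \<partial>((lborel \<Otimes>\<^sub>M lborel) \<Otimes>\<^sub>M lborel)) =
      (\<integral>\<^sup>+z. \<integral>\<^sup>+\<sigma>. ?P (fst z) (snd z) \<sigma> \<partial>lborel \<partial>(lborel \<Otimes>\<^sub>M lborel))"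
    by (subst lborel.nn_integral_fst[symmetric]) auto
  also have "\<dots> = (\<integral>\<^sup>+x. \<integral>\<^sup>+s. \<integral>\<^sup>+\<sigma>. ?P x s \<sigma> \<partial>lborel \<partial>lborel \<partial>lborel)"
    by (subst lborel.nn_integral_fst[symmetric]) auto
  also have "\<dots> \<le> (\<integral>\<^sup>+x. ?W * (\<integral>\<^sup>+s. ennreal ((D s x)\<^sup>2) \<partial>lborel) \<partial>lborel)"
    unfolding memory_density_def
    by (intro nn_integral_mono nn_integral_one_sided_power_form_le \<alpha> D_supp) measurable
  also have "\<dots> = ?W * (\<integral>\<^sup>+x. \<integral>\<^sup>+s. ennreal ((D s x)\<^sup>2) \<partial>lborel \<partial>lborel)"
    by (rule nn_integral_cmult) measurable
  also have "(\<integral>\<^sup>+x. \<integral>\<^sup>+s. ennreal ((D s x)\<^sup>2) \<partial>lborel \<partial>lborel) =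
      (\<integral>\<^sup>+z. ennreal (case z of (t, x) \<Rightarrow> (D t x)\<^sup>2) \<partial>(lborel \<Otimes>\<^sub>M lborel))"
    by (subst lborel_pair.nn_integral_snd[symmetric]) auto
  also have "?W * \<dots> < \<infinity>"
    using D_L2 by (subst nn_integral_eq_integral) (auto simp: ennreal_mult_less_top)
  finally show "(\<integral>\<^sup>+p. ennreal (norm (case p of (z, \<sigma>) \<Rightarrow> memory_density \<alpha> D (fst z) (snd z) \<sigma>))
        \<partial>((lborel \<Otimes>\<^sub>M lborel) \<Otimes>\<^sub>M lborel)) < \<infinity>" .
qed measurable

lemma integrable_memory_density_weighted:
  assumes [measurable]: "A \<in> sets borel" "B \<in> sets borel"
  shows "integrable ((lborel \<Otimes>\<^sub>M lborel) \<Otimes>\<^sub>M lborel)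
     (\<lambda>(z, \<sigma>). indicator A (snd z) * (indicator B \<sigma> * memory_density \<alpha> D (fst z) (snd z) \<sigma>))"
  by (rule Bochner_Integration.integrable_bound[OF integrable_memory_density])
    (measurable, auto simp: indicator_def)

lemma integrable_memory_rate:
  assumes [measurable]: "A \<in> sets borel" "B \<in> sets borel"
  shows "integrable (lborel \<Otimes>\<^sub>M lborel)
     (\<lambda>(x, s). indicator A s * (LINT \<sigma>|lborel. indicator B \<sigma> * memory_density \<alpha> D x s \<sigma>))"
  using pair_sigma_finite_pair_left.integrable_fst'[OF integrable_memory_density_weighted[OF assms]]
  by (simp add: case_prod_beta')

lemma set_integrable_memory_power:
  "set_integrable lborel {a..b} (\<lambda>s. LINT x|lborel. LINT \<sigma>|lborel. memory_density \<alpha> D x s \<sigma>)"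
  unfolding set_integrable_def
  using lborel_pair.integrable_snd[OF integrable_memory_rate[of "{a..b}" UNIV]] by simp

text \<open>
  On the left time is the outer variable, as it comes out of the fundamental theorem of calculus; on
  the right space is outermost, as in the definitions of the history energy and of the quadratic
  form. The memory is cut at \<open>\<sigma> = a\<close>.
\<close>

lemma memory_power_split:
  assumes "0 \<le> a"
  shows "(LINT s:{a..b}|lborel. LINT x|lborel. LINT \<sigma>|lborel. memory_density \<alpha> D x s \<sigma>) =
    (LINT x|lborel. (LINT s:{a..b}|lborel. LINT \<sigma>:{0..a}|lborel. memory_density \<alpha> D x s \<sigma>)) +
    (LINT x|lborel. (LINT s:{a..b}|lborel. LINT \<sigma>:{a..s}|lborel. memory_density \<alpha> D x s \<sigma>))"
proof -
  define q where "q B = (\<lambda>(x, s). indicator {a..b} s *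
      (LINT \<sigma>|lborel. indicator B \<sigma> * memory_density \<alpha> D x s \<sigma>))" for B
  have q_int: "integrable (lborel \<Otimes>\<^sub>M lborel) (q B)" if "B \<in> sets borel" for B
    unfolding q_def using that by (intro integrable_memory_rate) auto
  have iter: "(LINT x|lborel. LINT s|lborel. q B (x, s)) = (LINT z|(lborel \<Otimes>\<^sub>M lborel). q B z)"
    if "B \<in> sets borel" for B
    by (rule lborel_pair.integral_fst'[OF q_int[OF that]])
  have "AE z in lborel \<Otimes>\<^sub>M lborel. q UNIV z = q {..a} z + q {a..} z"
  proof -
    have *: "AE z in lborel \<Otimes>\<^sub>M lborel. integrable lborel (\<lambda>\<sigma>. indicator {a..b} (snd z) *
        (indicator B \<sigma> * memory_density \<alpha> D (fst z) (snd z) \<sigma>))" if "B \<in> sets borel" for B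
      using pair_sigma_finite_pair_left.AE_integrable_fst'[OF integrable_memory_density_weighted[of "{a..b}" B]]
        that by simp
    have "{..a} \<in> sets borel" "{a..} \<in> sets borel" by auto
    from this[THEN *] show ?thesis
    proof eventually_elim
      fix z :: "'a \<times> real"
      let ?r = "\<lambda>B \<sigma>. indicator {a..b} (snd z) * (indicator B \<sigma> * memory_density \<alpha> D (fst z) (snd z) \<sigma>)"
      assume i: "integrable lborel (?r {..a})" "integrable lborel (?r {a..})"
      \<comment> \<open>The two half-lines overlap in the single point \<open>a\<close>.\<close>
      have "(LINT \<sigma>|lborel. ?r UNIV \<sigma>) = (LINT \<sigma>|lborel. ?r {..a} \<sigma> + ?r {a..} \<sigma>)"
        by (rule integral_discrete_difference[where X = "{a}"]) (auto simp: indicator_def)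
      also have "\<dots> = (LINT \<sigma>|lborel. ?r {..a} \<sigma>) + (LINT \<sigma>|lborel. ?r {a..} \<sigma>)"
        by (rule Bochner_Integration.integral_add[OF i])
      finally show "q UNIV z = q {..a} z + q {a..} z"
        by (simp add: q_def case_prod_beta)
    qed
  qed
  then have "(LINT z|(lborel \<Otimes>\<^sub>M lborel). q UNIV z) = (LINT z|(lborel \<Otimes>\<^sub>M lborel). q {..a} z + q {a..} z)"
    using q_int[of UNIV] q_int[of "{..a}"] q_int[of "{a..}"] by (intro integral_cong_AE) auto
  also have "\<dots> = (LINT z|(lborel \<Otimes>\<^sub>M lborel). q {..a} z) + (LINT z|(lborel \<Otimes>\<^sub>M lborel). q {a..} z)"
    using q_int[of "{..a}"] q_int[of "{a..}"] by (intro Bochner_Integration.integral_add) auto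
  finally have split: "(LINT x|lborel. LINT s|lborel. q UNIV (x, s)) =
      (LINT x|lborel. LINT s|lborel. q {..a} (x, s)) + (LINT x|lborel. LINT s|lborel. q {a..} (x, s))"
    by (simp add: iter)
  have history: "(LINT s|lborel. q {..a} (x, s)) =
      (LINT s:{a..b}|lborel. LINT \<sigma>:{0..a}|lborel. memory_density \<alpha> D x s \<sigma>)" for x
    using D_supp[of _ x] unfolding set_lebesgue_integral_def q_def
    by (auto intro!: Bochner_Integration.integral_cong simp: indicator_def memory_density_def)
  have recent: "(LINT s|lborel. q {a..} (x, s)) =
      (LINT s:{a..b}|lborel. LINT \<sigma>:{a..s}|lborel. memory_density \<alpha> D x s \<sigma>)" for x
    \<comment> \<open>The upper limit \<open>s\<close> is already enforced by the kernel, which vanishes for \<open>\<sigma> \<ge> s\<close>.\<close>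
    unfolding set_lebesgue_integral_def q_def
    by (auto intro!: Bochner_Integration.integral_cong
        simp: indicator_def memory_density_def one_sided_power_def)
  have "(LINT s:{a..b}|lborel. LINT x|lborel. LINT \<sigma>|lborel. memory_density \<alpha> D x s \<sigma>) =
      (LINT s|lborel. LINT x|lborel. q UNIV (x, s))"
    by (simp add: q_def set_lebesgue_integral_def)
  also have "\<dots> = (LINT x|lborel. LINT s|lborel. q UNIV (x, s))"
    using q_int[of UNIV] by (intro lborel_pair.Fubini_integral) simp
  also note split
  finally show ?thesis by (simp only: history recent)
qed

lemma local_memory_nonneg:
  "0 \<le> (LINT x|lborel. (LINT s:{a..b}|lborel. LINT \<sigma>:{a..s}|lborel. memory_density \<alpha> D x s \<sigma>))"
proof (rule integral_nonneg_AE)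
  show "AE x in lborel. 0 \<le> (LINT s:{a..b}|lborel. LINT \<sigma>:{a..s}|lborel. memory_density \<alpha> D x s \<sigma>)"
    using AE_time_square_integrable
  proof eventually_elim
    fix x assume L2: "integrable lborel (\<lambda>t. (D t x)\<^sup>2)"
    define f where "f s = indicator {a..b} s * D s x" for s
    have [measurable]: "f \<in> borel_measurable borel" unfolding f_def[abs_def] by measurable
    have "integrable lborel (\<lambda>s. (f s)\<^sup>2)"
      by (rule Bochner_Integration.integrable_bound[OF L2]) (auto simp: f_def indicator_def)
    then have "0 \<le> (LINT s|lborel. LINT \<sigma>|lborel. one_sided_power \<alpha> (s - \<sigma>) * f \<sigma> * f s)"
      using D_supp by (intro one_sided_power_form_nonneg[OF \<alpha>, of f T]) (auto simp: f_def)
    also have "\<dots> = (LINT s:{a..b}|lborel. LINT \<sigma>:{a..s}|lborel. memory_density \<alpha> D x s \<sigma>)"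
      unfolding set_lebesgue_integral_def integral_scaleR_right[symmetric]
      by (intro Bochner_Integration.integral_cong refl)
        (auto simp: f_def indicator_def memory_density_def one_sided_power_def)
    finally show "0 \<le> (LINT s:{a..b}|lborel. LINT \<sigma>:{a..s}|lborel. memory_density \<alpha> D x s \<sigma>)" .
  qed
qed

text \<open>
  Only the end points 0 and \<open>T\<close> of the domain of integration can see a difference between \<open>g\<close> and
  \<open>h\<close>. Changing an integrand at finitely many points preserves the integral also when the integrand
  is not measurable, as both integrals are then 0 by default. At \<open>\<sigma> = s\<close> both kernels are 0, since
  \<open>0 powr a = 0\<close>.
\<close>

lemma weakly_singular_integral_cong:
  assumes eq: "\<And>\<sigma>. \<sigma> \<in> {0<..<T} \<Longrightarrow> g \<sigma> = h \<sigma>" and "0 \<le> u" "v \<le> s" "s \<le> T"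
  shows "(LINT \<sigma>:{u..v}|lborel. (s - \<sigma>) powr (-\<alpha>) * g \<sigma>) =
    (LINT \<sigma>:{u..v}|lborel. one_sided_power \<alpha> (s - \<sigma>) * h \<sigma>)"
  unfolding set_lebesgue_integral_def
proof (rule integral_discrete_difference[where X = "{0, T}"])
  fix \<sigma> :: real assume "\<sigma> \<notin> {0, T}"
  then show "indicator {u..v} \<sigma> *\<^sub>R ((s - \<sigma>) powr (-\<alpha>) * g \<sigma>) =
      indicator {u..v} \<sigma> *\<^sub>R (one_sided_power \<alpha> (s - \<sigma>) * h \<sigma>)"
    using assms by (cases "\<sigma> = s") (auto simp: indicator_def one_sided_power_def)
qed auto

lemma F_hist_eq_memory_density:
  assumes D: "\<And>t x. t \<in> {0<..<T} \<Longrightarrow> x \<in> \<Omega> \<Longrightarrow> D t x = d\<phi> t x" "\<And>t x. x \<notin> \<Omega> \<Longrightarrow> D t x = 0"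
    and ab: "0 \<le> a" "b \<le> T"
  shows "F_hist \<alpha> \<Omega> d\<phi> a b = 1 / Gamma (1 - \<alpha>) *
    (LINT x|lborel. (LINT s:{a..b}|lborel. LINT \<sigma>:{0..a}|lborel. memory_density \<alpha> D x s \<sigma>))"
proof -
  have "indicator \<Omega> x *\<^sub>R (LINT s:{a..b}|lborel. history_derivative \<alpha> a (\<lambda>\<sigma>. d\<phi> \<sigma> x) s * d\<phi> s x) =
      1 / Gamma (1 - \<alpha>) * (LINT s:{a..b}|lborel. LINT \<sigma>:{0..a}|lborel. memory_density \<alpha> D x s \<sigma>)" for x
  proof (cases "x \<in> \<Omega>")
    case True
    have "(LINT s:{a..b}|lborel. history_derivative \<alpha> a (\<lambda>\<sigma>. d\<phi> \<sigma> x) s * d\<phi> s x) =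
        (LINT s:{a..b}|lborel. 1 / Gamma (1 - \<alpha>) * (LINT \<sigma>:{0..a}|lborel. memory_density \<alpha> D x s \<sigma>))"
      unfolding set_lebesgue_integral_def[of _ "{a..b}"]
    proof (rule integral_discrete_difference[where X = "{0, T}"])
      fix s :: real assume s: "s \<notin> {0, T}"
      have "history_derivative \<alpha> a (\<lambda>\<sigma>. d\<phi> \<sigma> x) s * d\<phi> s x =
          1 / Gamma (1 - \<alpha>) * (LINT \<sigma>:{0..a}|lborel. memory_density \<alpha> D x s \<sigma>)" if "s \<in> {a..b}"
      proof -
        have "history_derivative \<alpha> a (\<lambda>\<sigma>. d\<phi> \<sigma> x) s =
            1 / Gamma (1 - \<alpha>) * (LINT \<sigma>:{0..a}|lborel. one_sided_power \<alpha> (s - \<sigma>) * D \<sigma> x)"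
          unfolding history_derivative_def using that ab True
          by (subst weakly_singular_integral_cong[of _ "\<lambda>\<sigma>. D \<sigma> x"]) (auto simp: D(1))
        moreover have "D s x = d\<phi> s x" using s that ab True by (intro D(1)) auto
        ultimately show ?thesis by (simp add: memory_density_def)
      qed
      then show "indicator {a..b} s *\<^sub>R (history_derivative \<alpha> a (\<lambda>\<sigma>. d\<phi> \<sigma> x) s * d\<phi> s x) =
          indicator {a..b} s *\<^sub>R (1 / Gamma (1 - \<alpha>) * (LINT \<sigma>:{0..a}|lborel. memory_density \<alpha> D x s \<sigma>))"
        by (auto simp: indicator_def)
    qed auto
    with True show ?thesis by simp
  qed (simp add: memory_density_def D(2))
  then show ?thesis
    unfolding F_hist_def set_lebesgue_integral_def[of _ \<Omega>] by simp
qed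

lemma A_form_eq_memory_density:
  assumes D: "\<And>t x. t \<in> {0<..<T} \<Longrightarrow> x \<in> \<Omega> \<Longrightarrow> D t x = d\<phi> t x" "\<And>t x. x \<notin> \<Omega> \<Longrightarrow> D t x = 0"
    and ab: "0 \<le> a" "b \<le> T"
  shows "(LINT x:\<Omega>|lborel. A_form \<alpha> a b (\<lambda>t. d\<phi> t x) (\<lambda>t. d\<phi> t x)) = 1 / Gamma (1 - \<alpha>) *
    (LINT x|lborel. (LINT s:{a..b}|lborel. LINT \<sigma>:{a..s}|lborel. memory_density \<alpha> D x s \<sigma>))"
proof -
  have "indicator \<Omega> x *\<^sub>R A_form \<alpha> a b (\<lambda>t. d\<phi> t x) (\<lambda>t. d\<phi> t x) =
      1 / Gamma (1 - \<alpha>) * (LINT s:{a..b}|lborel. LINT \<sigma>:{a..s}|lborel. memory_density \<alpha> D x s \<sigma>)" for x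
  proof (cases "x \<in> \<Omega>")
    case True
    have "(LINT s:{a..b}|lborel. LINT \<sigma>:{a..s}|lborel. (s - \<sigma>) powr (-\<alpha>) * d\<phi> \<sigma> x * d\<phi> s x) =
        (LINT s:{a..b}|lborel. LINT \<sigma>:{a..s}|lborel. memory_density \<alpha> D x s \<sigma>)"
      unfolding set_lebesgue_integral_def[of _ "{a..b}"]
    proof (rule integral_discrete_difference[where X = "{0, T}"])
      fix s :: real assume s: "s \<notin> {0, T}"
      have "(LINT \<sigma>:{a..s}|lborel. (s - \<sigma>) powr (-\<alpha>) * d\<phi> \<sigma> x * d\<phi> s x) =
          (LINT \<sigma>:{a..s}|lborel. memory_density \<alpha> D x s \<sigma>)" if "s \<in> {a..b}"
      proof -
        have "D s x = d\<phi> s x" using s that ab True by (intro D(1)) auto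
        moreover have "(LINT \<sigma>:{a..s}|lborel. (s - \<sigma>) powr (-\<alpha>) * (d\<phi> \<sigma> x)) =
            (LINT \<sigma>:{a..s}|lborel. one_sided_power \<alpha> (s - \<sigma>) * D \<sigma> x)"
          using that ab True by (intro weakly_singular_integral_cong) (auto simp: D(1))
        ultimately show ?thesis by (simp add: memory_density_def)
      qed
      then show "indicator {a..b} s *\<^sub>R (LINT \<sigma>:{a..s}|lborel. (s - \<sigma>) powr (-\<alpha>) * d\<phi> \<sigma> x * d\<phi> s x) =
          indicator {a..b} s *\<^sub>R (LINT \<sigma>:{a..s}|lborel. memory_density \<alpha> D x s \<sigma>)"
        by (auto simp: indicator_def)
    qed auto
    with True show ?thesis by (simp add: A_form_def)
  qed (simp add: memory_density_def D(2))
  then show ?thesis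
    unfolding set_lebesgue_integral_def[of _ \<Omega>] by simp
qed

text \<open>
  Testing the equation with the time derivative: \<open>g\<close> is minus the Caputo derivative almost everywhere
  in \<open>\<Omega>\<close>, so its inner product with \<open>d\<phi> t\<close> is minus the total memory power at time \<open>t\<close>.
\<close>

lemma L2_inner_caputo_eq_memory_power:
  assumes D: "\<And>t x. t \<in> {0<..<T} \<Longrightarrow> x \<in> \<Omega> \<Longrightarrow> D t x = d\<phi> t x" "\<And>t x. x \<notin> \<Omega> \<Longrightarrow> D t x = 0"
    and t: "t \<in> {0<..<T}" and g: "set_borel_measurable lborel \<Omega> g"
    and flow: "AE x\<in>\<Omega> in lborel. caputo_derivative \<alpha> (\<lambda>s. d\<phi> s x) t = - g x"
  shows "L2_inner \<Omega> g (d\<phi> t) =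
    - (1 / Gamma (1 - \<alpha>)) * (LINT x|lborel. LINT \<sigma>|lborel. memory_density \<alpha> D x t \<sigma>)"
proof -
  let ?c = "1 / Gamma (1 - \<alpha>)"
  have caputo: "caputo_derivative \<alpha> (\<lambda>s. d\<phi> s x) t =
      ?c * (LINT \<sigma>|lborel. one_sided_power \<alpha> (t - \<sigma>) * D \<sigma> x)" if "x \<in> \<Omega>" for x
  proof -
    have "caputo_derivative \<alpha> (\<lambda>s. d\<phi> s x) t =
        ?c * (LINT \<sigma>:{0..t}|lborel. one_sided_power \<alpha> (t - \<sigma>) * D \<sigma> x)"
      unfolding caputo_derivative_def using that t
      by (subst weakly_singular_integral_cong[of _ "\<lambda>\<sigma>. D \<sigma> x"]) (auto simp: D(1))
    also have "(LINT \<sigma>:{0..t}|lborel. one_sided_power \<alpha> (t - \<sigma>) * D \<sigma> x) =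
        (LINT \<sigma>|lborel. one_sided_power \<alpha> (t - \<sigma>) * D \<sigma> x)"
      unfolding set_lebesgue_integral_def using D_supp[of _ x]
      by (intro Bochner_Integration.integral_cong) (auto simp: indicator_def one_sided_power_def)
    finally show ?thesis .
  qed
  have gm [measurable]: "(\<lambda>x. indicator \<Omega> x * g x) \<in> borel_measurable borel"
    using g by (simp add: set_borel_measurable_def)
  have "L2_inner \<Omega> g (d\<phi> t) = (LINT x|lborel. (indicator \<Omega> x * g x) * D t x)"
    unfolding L2_inner_def set_lebesgue_integral_def using D(1)[OF t]
    by (intro Bochner_Integration.integral_cong) (auto simp: indicator_def)
  also have "\<dots> = (LINT x|lborel. - ?c * (LINT \<sigma>|lborel. memory_density \<alpha> D x t \<sigma>))"
  proof (rule integral_cong_AE)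
    show "AE x in lborel. (indicator \<Omega> x * g x) * D t x =
        - ?c * (LINT \<sigma>|lborel. memory_density \<alpha> D x t \<sigma>)"
      using flow
    proof eventually_elim
      fix x assume *: "x \<in> \<Omega> \<longrightarrow> caputo_derivative \<alpha> (\<lambda>s. d\<phi> s x) t = - g x"
      show "(indicator \<Omega> x * g x) * D t x = - ?c * (LINT \<sigma>|lborel. memory_density \<alpha> D x t \<sigma>)"
      proof (cases "x \<in> \<Omega>")
        case True
        then have "g x = - ?c * (LINT \<sigma>|lborel. one_sided_power \<alpha> (t - \<sigma>) * D \<sigma> x)"
          using * caputo[OF True] by simp
        then show ?thesis using True by (simp add: memory_density_def)
      qed (simp add: memory_density_def D(2))
    qed
  qed measurable
  finally show ?thesis by simp
qed

end

lemma square_integrable_field_restriction: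
  assumes "0 < \<alpha>" "\<alpha> < 1" and L2: "L2_on ({0<..<T} \<times> \<Omega>) (\<lambda>(t, x). d\<phi> t x)"
  shows "square_integrable_field \<alpha> T (\<lambda>t x. indicator ({0<..<T} \<times> \<Omega>) (t, x) * d\<phi> t x)"
proof
  let ?D = "\<lambda>(t, x). indicator ({0<..<T} \<times> \<Omega>) (t, x) * d\<phi> t x"
  show "?D \<in> borel_measurable (lborel \<Otimes>\<^sub>M lborel)"
    using L2 unfolding L2_on_def set_borel_measurable_def lborel_prod by (simp add: case_prod_beta')
  have "(\<lambda>(t, x). (indicator ({0<..<T} \<times> \<Omega>) (t, x) * d\<phi> t x)\<^sup>2) =
      (\<lambda>z. indicator ({0<..<T} \<times> \<Omega>) z *\<^sub>R ((\<lambda>(t, x). d\<phi> t x) z)\<^sup>2)"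
    by (auto simp: fun_eq_iff indicator_def)
  then show "integrable (lborel \<Otimes>\<^sub>M lborel) (\<lambda>(t, x). (indicator ({0<..<T} \<times> \<Omega>) (t, x) * d\<phi> t x)\<^sup>2)"
    using L2 unfolding L2_on_def set_integrable_def lborel_prod by simp
qed (use assms in \<open>auto simp: indicator_def\<close>)

text \<open>
  The energy identity on an arbitrary time interval: what \<open>E\<close> loses is the work of the history from
  before \<open>a\<close> plus the dissipation produced by the memory built up since \<open>a\<close>.
\<close>

lemma energy_balance:
  fixes \<Omega> :: "'a::euclidean_space set"
  assumes \<alpha>: "0 < \<alpha>" "\<alpha> < 1"
    and flow: "fractional_gradient_flow \<alpha> T \<Omega> E gradE \<phi> d\<phi>"
    and ac: "abs_continuous_on_interval 0 T (\<lambda>t. E (\<phi> t))"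
    and chain: "AE t\<in>{0<..<T} in lborel.
      ((\<lambda>t. E (\<phi> t)) has_real_derivative L2_inner \<Omega> (gradE (\<phi> t)) (d\<phi> t)) (at t)"
    and ab: "0 \<le> a" "a \<le> b" "b \<le> T"
  shows "E (\<phi> b) - E (\<phi> a) = - F_hist \<alpha> \<Omega> d\<phi> a b
      - (LINT x:\<Omega>|lborel. A_form \<alpha> a b (\<lambda>t. d\<phi> t x) (\<lambda>t. d\<phi> t x))"
    and "0 \<le> (LINT x:\<Omega>|lborel. A_form \<alpha> a b (\<lambda>t. d\<phi> t x) (\<lambda>t. d\<phi> t x))"
proof -
  define D where "D t x = indicator ({0<..<T} \<times> \<Omega>) (t, x) * d\<phi> t x" for t x
  have D: "\<And>t x. t \<in> {0<..<T} \<Longrightarrow> x \<in> \<Omega> \<Longrightarrow> D t x = d\<phi> t x" "\<And>t x. x \<notin> \<Omega> \<Longrightarrow> D t x = 0"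
    by (auto simp: D_def)
  interpret square_integrable_field \<alpha> T D
    unfolding D_def[abs_def] using flow
    by (intro square_integrable_field_restriction \<alpha>)
      (auto simp: fractional_gradient_flow_def has_L2_time_derivative_def)
  let ?c = "1 / Gamma (1 - \<alpha>)"
  have F: "F_hist \<alpha> \<Omega> d\<phi> a b = ?c *
      (LINT x|lborel. (LINT s:{a..b}|lborel. LINT \<sigma>:{0..a}|lborel. memory_density \<alpha> D x s \<sigma>))"
    using ab by (intro F_hist_eq_memory_density D)
  have A: "(LINT x:\<Omega>|lborel. A_form \<alpha> a b (\<lambda>t. d\<phi> t x) (\<lambda>t. d\<phi> t x)) = ?c *
      (LINT x|lborel. (LINT s:{a..b}|lborel. LINT \<sigma>:{a..s}|lborel. memory_density \<alpha> D x s \<sigma>))"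
    using ab by (intro A_form_eq_memory_density D)
  define G where "G s = (LINT x|lborel. LINT \<sigma>|lborel. memory_density \<alpha> D x s \<sigma>)" for s
  have "AE t\<in>{a<..<b} in lborel. ((\<lambda>t. E (\<phi> t)) has_real_derivative - ?c * G t) (at t)"
  proof -
    have "AE t\<in>{0<..<T} in lborel. has_functional_derivative \<Omega> E (\<phi> t) (gradE (\<phi> t)) \<and>
        (AE x\<in>\<Omega> in lborel. caputo_derivative \<alpha> (\<lambda>s. d\<phi> s x) t = - gradE (\<phi> t) x)"
      using flow by (simp add: fractional_gradient_flow_def)
    then show ?thesis using chain
    proof eventually_elim
      case (elim t)
      show ?case
      proof
        assume "t \<in> {a<..<b}"
        then have t: "t \<in> {0<..<T}" using ab by auto
        then have "set_borel_measurable lborel \<Omega> (gradE (\<phi> t))"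
          using elim by (simp add: has_functional_derivative_def L2_on_def)
        then have "L2_inner \<Omega> (gradE (\<phi> t)) (d\<phi> t) = - ?c * G t"
          using elim t unfolding G_def by (intro L2_inner_caputo_eq_memory_power D) auto
        then show "((\<lambda>t. E (\<phi> t)) has_real_derivative - ?c * G t) (at t)"
          using elim t by simp
      qed
    qed
  qed
  then have "((\<lambda>t. - ?c * G t) has_integral E (\<phi> b) - E (\<phi> a)) {a..b}"
    using ac ab by (intro fundamental_theorem_of_calculus_abs_continuous) auto
  moreover have "set_integrable lborel {a..b} G"
    unfolding G_def[abs_def] by (rule set_integrable_memory_power)
  then have "set_integrable lborel {a..b} (\<lambda>t. - ?c * G t)"
    by (intro set_integrable_mult_right) simp
  ultimately have "E (\<phi> b) - E (\<phi> a) = (LINT t:{a..b}|lborel. - ?c * G t)"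
    using set_borel_integral_eq_integral(2) integral_unique by metis
  also have "\<dots> = - ?c * (LINT t:{a..b}|lborel. G t)"
    by (rule set_integral_mult_right)
  also have "\<dots> = - F_hist \<alpha> \<Omega> d\<phi> a b
      - (LINT x:\<Omega>|lborel. A_form \<alpha> a b (\<lambda>t. d\<phi> t x) (\<lambda>t. d\<phi> t x))"
    unfolding F A G_def memory_power_split[OF ab(1)]
    by (simp add: algebra_simps add_divide_distrib)
  finally show "E (\<phi> b) - E (\<phi> a) = - F_hist \<alpha> \<Omega> d\<phi> a b
      - (LINT x:\<Omega>|lborel. A_form \<alpha> a b (\<lambda>t. d\<phi> t x) (\<lambda>t. d\<phi> t x))" .
  have "0 < Gamma (1 - \<alpha>)" using \<alpha> by (intro Gamma_real_pos) auto
  then show "0 \<le> (LINT x:\<Omega>|lborel. A_form \<alpha> a b (\<lambda>t. d\<phi> t x) (\<lambda>t. d\<phi> t x))"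
    unfolding A
    by (intro mult_nonneg_nonneg local_memory_nonneg) auto
qed

theorem mainTheorem1:
  fixes \<alpha> T :: real and \<Omega> :: "(real ^ 'd) set"
    and E :: "((real ^ 'd) \<Rightarrow> real) \<Rightarrow> real"
    and gradE :: "((real ^ 'd) \<Rightarrow> real) \<Rightarrow> (real ^ 'd) \<Rightarrow> real"
    and \<phi> d\<phi> :: "real \<Rightarrow> (real ^ 'd) \<Rightarrow> real"
    and M :: nat and \<tau> :: "nat \<Rightarrow> real"
  assumes "0 < \<alpha>" and "\<alpha> < 1" and "0 < T"
    and "CARD('d) \<in> {1, 2, 3}"
    and "open \<Omega>" and "connected \<Omega>" and "\<Omega> \<noteq> {}" and "bounded \<Omega>"
    and "fractional_gradient_flow \<alpha> T \<Omega> E gradE \<phi> d\<phi>"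
    and "abs_continuous_on_interval 0 T (\<lambda>t. E (\<phi> t))"
    and "AE t\<in>{0<..<T} in lborel.
      ((\<lambda>t. E (\<phi> t)) has_real_derivative L2_inner \<Omega> (gradE (\<phi> t)) (d\<phi> t)) (at t)"
    and "time_mesh T M \<tau>"
  shows "\<forall>n<M.
    nonlocal_energy \<alpha> \<Omega> E \<tau> \<phi> d\<phi> (\<tau> (n + 1)) - nonlocal_energy \<alpha> \<Omega> E \<tau> \<phi> d\<phi> (\<tau> n)
      = - (LINT x:\<Omega>|lborel. A_form \<alpha> (\<tau> n) (\<tau> (n + 1)) (\<lambda>t. d\<phi> t x) (\<lambda>t. d\<phi> t x)) \<and>
    - (LINT x:\<Omega>|lborel. A_form \<alpha> (\<tau> n) (\<tau> (n + 1)) (\<lambda>t. d\<phi> t x) (\<lambda>t. d\<phi> t x)) \<le> 0"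
proof (intro allI impI)
  fix n assume n: "n < M"
  have mesh: "0 \<le> \<tau> n" "\<tau> n \<le> \<tau> (n + 1)" "\<tau> (n + 1) \<le> T"
    using time_mesh_le[OF assms(12), of 0 n] time_mesh_le[OF assms(12), of n "n + 1"]
      time_mesh_le[OF assms(12), of "n + 1" M] n assms(12) by (auto simp: time_mesh_def)
  note balance = energy_balance[OF assms(1,2,9,10,11) mesh]
  \<comment> \<open>The sums over the earlier intervals cancel, and at the left end the running history term vanishes.\<close>
  have jump: "nonlocal_energy \<alpha> \<Omega> E \<tau> \<phi> d\<phi> (\<tau> (n + 1)) - nonlocal_energy \<alpha> \<Omega> E \<tau> \<phi> d\<phi> (\<tau> n) =
      E (\<phi> (\<tau> (n + 1))) - E (\<phi> (\<tau> n)) + F_hist \<alpha> \<Omega> d\<phi> (\<tau> n) (\<tau> (n + 1))"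
  proof -
    consider "n = 0" | "n = 1" | "2 \<le> n" by linarith
    then show ?thesis
    proof cases
      case 1
      have "\<tau> 0 = 0" using assms(12) by (simp add: time_mesh_def)
      then have "F_hist \<alpha> \<Omega> d\<phi> (\<tau> 0) (\<tau> 1) = 0"
        by (simp add: F_hist_def history_derivative_from_start)
      then show ?thesis
        using 1 mesh by (simp add: nonlocal_energy_first[OF assms(12)])
    next
      case 2
      then show ?thesis
        using mesh by (simp add: nonlocal_energy_second[OF assms(12)] numeral_2_eq_2)
    next
      case 3
      then show ?thesis
        using n mesh by (simp add: nonlocal_energy_later[OF assms(12) 3 n])
    qed
  qed
  show "nonlocal_energy \<alpha> \<Omega> E \<tau> \<phi> d\<phi> (\<tau> (n + 1)) - nonlocal_energy \<alpha> \<Omega> E \<tau> \<phi> d\<phi> (\<tau> n)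
      = - (LINT x:\<Omega>|lborel. A_form \<alpha> (\<tau> n) (\<tau> (n + 1)) (\<lambda>t. d\<phi> t x) (\<lambda>t. d\<phi> t x)) \<and>
    - (LINT x:\<Omega>|lborel. A_form \<alpha> (\<tau> n) (\<tau> (n + 1)) (\<lambda>t. d\<phi> t x) (\<lambda>t. d\<phi> t x)) \<le> 0"
    using jump balance by simp
qed

end
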